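(* Let $V$ be an affine variety over an infinite field $k$. Let $S\subseteq k^n$ be an algebraic set such that $S\cong V$ as affine $k$-varieties. Then $S$ is fundamental (resp. locally fundamental) if and only if every regular function $g: V\to \mathbb{A}^1_k$ such that $g\otimes_k k^{\mathrm{alg}}$ factors through the inclusion map $\mathbb{G}_m(k^{\mathrm{alg}})\hookrightarrow \mathbb{A}^1_{k^{\mathrm{alg}}}$ is constant (resp. locally constant). In particular, being fundamental (resp. locally fundamental) is independent of the embedding of an affine variety as an algebraic set in some $k^n$.
   Context: $k^{\mathrm{alg}}$ denotes an algebraic closure of $k$. An affine algebraic set $S\subseteq k^n$ is the common zero set in $k^n$ of some subset of $k[X_1,\ldots,X_n]$. Such sets are the closed sets of the Zariski topology on $k^n$, and $S$ carries the subspace topology. Let $\bar S$ be the Zariski closure of $S$ in $(k^{\mathrm{alg}})^n$. $S$ is fundamental (over $k$) if for every $f\in k[X_1,\ldots,X_n]$ that is not constant on $S$ there is $p\in \bar S$ with $f(p)=0$. $S$ is locally fundamental if for every $f\in k[X_1,\ldots,X_n]$ that is not locally constant on $S$ there is $p\in\bar S$ with $f(p)=0$. An algebraic set $S\subseteq k^n$ is regarded as an affine $k$-variety with coordinate ring $k[X_1,\ldots,X_n]/I(S)$, where $I(S)$ is the ideal of polynomials vanishing on $S$; regular functions on $S$ are those induced by polynomials. $V\otimes_k k^{\mathrm{alg}}$ denotes the base change of $V$ to $k^{\mathrm{alg}}$ (for $V=S$ it corresponds to $\bar S$), and $g\otimes_k k^{\mathrm{alg}}: V\otimes_k k^{\mathrm{alg}}\to\mathbb{A}^1_{k^{\mathrm{alg}}}$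 is the base change of $g$. $\mathbb{G}_m(k^{\mathrm{alg}})=\mathbb{A}^1_{k^{\mathrm{alg}}}\setminus\{0\}$. *)

theory Defs
  imports
    "HOL-Library.Poly_Mapping"
    "HOL-Library.FuncSet"
    "HOL-Analysis.Abstract_Topology_2"
    "HOL-Algebra.Algebra"
    "HOL-Algebra.Algebraic_Closure_Type"
begin

section \<open>Polynomials and algebraic sets\<close>

text \<open>
  Points of \<open>k\<^sup>n\<close> are extensional functions on \<open>{..<n}\<close>. Polynomials are finitely
  supported maps from monomials (finitely supported exponent vectors) to coefficients,
  restricted to the variables with index below \<open>n\<close>.
\<close>

type_synonym 'a mpoly = "(nat \<Rightarrow>\<^sub>0 nat) \<Rightarrow>\<^sub>0 'a"

definition affine_space :: "nat \<Rightarrow> (nat \<Rightarrow> 'a) set" where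
  "affine_space n = {..<n} \<rightarrow>\<^sub>E UNIV"

definition polys :: "nat \<Rightarrow> 'a::zero mpoly set" where
  "polys n = {f. \<forall>m \<in> Poly_Mapping.keys f. Poly_Mapping.keys m \<subseteq> {..<n}}"

text \<open>Evaluation at \<open>x\<close> after mapping the coefficients along \<open>h\<close>.\<close>

definition eval_along :: "('a::zero \<Rightarrow> 'b::comm_semiring_1) \<Rightarrow> 'a mpoly \<Rightarrow> (nat \<Rightarrow> 'b) \<Rightarrow> 'b" where
  "eval_along h f x =
     (\<Sum>m\<in>Poly_Mapping.keys f. h (Poly_Mapping.lookup f m) *
        (\<Prod>i\<in>Poly_Mapping.keys m. x i ^ Poly_Mapping.lookup m i))"

abbreviation mpoly_eval :: "'a::comm_semiring_1 mpoly \<Rightarrow> (nat \<Rightarrow> 'a) \<Rightarrow> 'a" where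
  "mpoly_eval \<equiv> eval_along (\<lambda>c. c)"

definition algebraic_set :: "nat \<Rightarrow> (nat \<Rightarrow> 'a::field) set \<Rightarrow> bool" where
  "algebraic_set n S \<longleftrightarrow>
     (\<exists>P \<subseteq> polys n. S = {x \<in> affine_space n. \<forall>f\<in>P. mpoly_eval f x = 0})"

definition zariski :: "nat \<Rightarrow> (nat \<Rightarrow> 'a::field) topology" where
  "zariski n = topology (\<lambda>U. U \<subseteq> affine_space n \<and> algebraic_set n (affine_space n - U))"

definition vanishing_ideal :: "nat \<Rightarrow> (nat \<Rightarrow> 'a::field) set \<Rightarrow> 'a mpoly set" where
  "vanishing_ideal n S = {f \<in> polys n. \<forall>x\<in>S. mpoly_eval f x = 0}"

subsection \<open>The Zariski topology is a topology\<close>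

lemma eval_along_superset:
  assumes "finite A" "Poly_Mapping.keys f \<subseteq> A" "h 0 = 0"
  shows "eval_along h f x = (\<Sum>m\<in>A. h (Poly_Mapping.lookup f m) *
           (\<Prod>i\<in>Poly_Mapping.keys m. x i ^ Poly_Mapping.lookup m i))"
  unfolding eval_along_def
  by (rule sum.mono_neutral_left) (use assms in \<open>auto simp: in_keys_iff\<close>)

lemma mpoly_eval_add: "mpoly_eval (f + g) x = mpoly_eval f x + mpoly_eval g x"
proof -
  let ?A = "Poly_Mapping.keys f \<union> Poly_Mapping.keys g"
  have A: "finite ?A" "Poly_Mapping.keys (f + g) \<subseteq> ?A"
    using Poly_Mapping.keys_add[of f g] by auto
  show ?thesis
    using A by (simp add: eval_along_superset[of ?A] lookup_add algebra_simps sum.distrib)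
qed

lemma mpoly_eval_0 [simp]: "mpoly_eval 0 x = 0"
  by (simp add: eval_along_def)

lemma mpoly_eval_sum: "mpoly_eval (\<Sum>a\<in>A. F a) x = (\<Sum>a\<in>A. mpoly_eval (F a) x)"
  by (induction A rule: infinite_finite_induct) (auto simp: mpoly_eval_add)

lemma mpoly_eval_single:
  "mpoly_eval (Poly_Mapping.single m c) x =
     c * (\<Prod>i\<in>Poly_Mapping.keys m. x i ^ Poly_Mapping.lookup m i)"
  by (cases "c = 0") (auto simp: eval_along_def)

lemma monom_eval_add:
  fixes x :: "nat \<Rightarrow> 'a::comm_semiring_1" and m m' :: "nat \<Rightarrow>\<^sub>0 nat"
  shows "(\<Prod>i\<in>Poly_Mapping.keys (m + m'). x i ^ Poly_Mapping.lookup (m + m') i) =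
    (\<Prod>i\<in>Poly_Mapping.keys m. x i ^ Poly_Mapping.lookup m i) *
    (\<Prod>i\<in>Poly_Mapping.keys m'. x i ^ Poly_Mapping.lookup m' i)"
proof -
  let ?A = "Poly_Mapping.keys m \<union> Poly_Mapping.keys m'"
  have "(\<Prod>i\<in>Poly_Mapping.keys p. x i ^ Poly_Mapping.lookup p i) =
      (\<Prod>i\<in>?A. x i ^ Poly_Mapping.lookup p i)" if "Poly_Mapping.keys p \<subseteq> ?A" for p
    by (rule prod.mono_neutral_left) (use that in \<open>auto simp: in_keys_iff\<close>)
  from this[of "m + m'"] this[of m] this[of m'] show ?thesis
    using Poly_Mapping.keys_add[of m m']
    by (simp only: Un_upper1 Un_upper2 lookup_add power_add prod.distrib)
qed

lemma mpoly_decompose: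
  "(\<Sum>m\<in>Poly_Mapping.keys f. Poly_Mapping.single m (Poly_Mapping.lookup f m)) = f"
  by (rule poly_mapping_eqI)
    (simp add: lookup_sum lookup_single when_def sum.delta in_keys_iff)

lemma mpoly_eval_mult:
  fixes f g :: "'a::comm_ring_1 mpoly"
  shows "mpoly_eval (f * g) x = mpoly_eval f x * mpoly_eval g x"
proof -
  have "f * g = (\<Sum>a\<in>Poly_Mapping.keys f. Poly_Mapping.single a (Poly_Mapping.lookup f a)) *
                (\<Sum>b\<in>Poly_Mapping.keys g. Poly_Mapping.single b (Poly_Mapping.lookup g b))"
    by (simp add: mpoly_decompose)
  also have "mpoly_eval \<dots> x = mpoly_eval f x * mpoly_eval g x"
    by (simp add: sum_product mult_single mpoly_eval_sum mpoly_eval_single monom_eval_add)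
      (simp add: eval_along_def sum_product mult_ac)
  finally show ?thesis .
qed

lemma polys_add: "f \<in> polys n \<Longrightarrow> g \<in> polys n \<Longrightarrow> f + g \<in> polys n"
  using Poly_Mapping.keys_add[of f g] by (auto simp: polys_def)

lemma polys_mult:
  fixes f g :: "'a::semiring_0 mpoly"
  assumes "f \<in> polys n" "g \<in> polys n" shows "f * g \<in> polys n"
  unfolding polys_def mem_Collect_eq
proof
  fix m assume "m \<in> Poly_Mapping.keys (f * g)"
  then obtain a b where "m = a + b" "a \<in> Poly_Mapping.keys f" "b \<in> Poly_Mapping.keys g"
    using Poly_Mapping.keys_mult[of f g] by blast
  with assms show "Poly_Mapping.keys m \<subseteq> {..<n}"
    using Poly_Mapping.keys_add[of a b] by (fastforce simp: polys_def)
qed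

lemma algebraic_set_iff:
  "algebraic_set n S \<longleftrightarrow>
     S = {x \<in> affine_space n. \<forall>f\<in>vanishing_ideal n S. mpoly_eval f x = 0}"
proof
  assume "algebraic_set n S"
  then obtain P where P: "P \<subseteq> polys n"
      "S = {x \<in> affine_space n. \<forall>f\<in>P. mpoly_eval f x = 0}"
    unfolding algebraic_set_def by blast
  then have "P \<subseteq> vanishing_ideal n S" by (auto simp: vanishing_ideal_def)
  then have "{x \<in> affine_space n. \<forall>f\<in>vanishing_ideal n S. mpoly_eval f x = 0} \<subseteq> S"
    using P(2) by auto
  moreover have "S \<subseteq> {x \<in> affine_space n. \<forall>f\<in>vanishing_ideal n S. mpoly_eval f x = 0}"
    using P(2) by (auto simp: vanishing_ideal_def)
  ultimately show "S = {x \<in> affine_space n. \<forall>f\<in>vanishing_ideal n S. mpoly_eval f x = 0}"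
    by (rule equalityI[rotated])
next
  assume "S = {x \<in> affine_space n. \<forall>f\<in>vanishing_ideal n S. mpoly_eval f x = 0}"
  moreover have "vanishing_ideal n S \<subseteq> polys n" by (auto simp: vanishing_ideal_def)
  ultimately show "algebraic_set n S" unfolding algebraic_set_def by blast
qed

lemma algebraic_set_Inter:
  assumes "\<And>S. S \<in> \<K> \<Longrightarrow> algebraic_set n S"
  shows "algebraic_set n (affine_space n \<inter> \<Inter>\<K>)"
  unfolding algebraic_set_def
proof (intro exI conjI)
  show "\<Union>(vanishing_ideal n ` \<K>) \<subseteq> polys n"
    by (auto simp: vanishing_ideal_def)
  show "affine_space n \<inter> \<Inter>\<K> =
      {x \<in> affine_space n. \<forall>f\<in>\<Union>(vanishing_ideal n ` \<K>). mpoly_eval f x = 0}"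
  proof -
    have "x \<in> S \<longleftrightarrow> (\<forall>f\<in>vanishing_ideal n S. mpoly_eval f x = 0)"
      if "S \<in> \<K>" "x \<in> affine_space n" for S x
      using assms[OF that(1)] that(2) unfolding algebraic_set_iff by auto
    then show ?thesis by auto
  qed
qed

lemma algebraic_set_Un:
  assumes "algebraic_set n S" "algebraic_set n T"
  shows "algebraic_set n (S \<union> T)"
proof -
  obtain P Q where PQ: "P \<subseteq> polys n" "Q \<subseteq> polys n"
    "S = {x \<in> affine_space n. \<forall>f\<in>P. mpoly_eval f x = 0}"
    "T = {x \<in> affine_space n. \<forall>f\<in>Q. mpoly_eval f x = 0}"
    using assms unfolding algebraic_set_def by blast
  show ?thesis unfolding algebraic_set_def
  proof (intro exI conjI)
    show "{f * g | f g. f \<in> P \<and> g \<in> Q} \<subseteq> polys n"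
      using PQ by (blast intro: polys_mult)
    show "S \<union> T = {x \<in> affine_space n.
        \<forall>h\<in>{f * g | f g. f \<in> P \<and> g \<in> Q}. mpoly_eval h x = 0}"
      unfolding PQ by (fastforce simp: mpoly_eval_mult)
  qed
qed

lemma istopology_zariski:
  "istopology (\<lambda>U. U \<subseteq> affine_space n \<and> algebraic_set n (affine_space n - U))"
  unfolding istopology_def
proof (intro conjI allI impI)
  fix S T :: "(nat \<Rightarrow> 'a) set"
  assume "S \<subseteq> affine_space n \<and> algebraic_set n (affine_space n - S)"
    and "T \<subseteq> affine_space n \<and> algebraic_set n (affine_space n - T)"
  then show "S \<inter> T \<subseteq> affine_space n" "algebraic_set n (affine_space n - S \<inter> T)"
    by (auto simp: Diff_Int intro: algebraic_set_Un)
next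
  fix \<K> :: "(nat \<Rightarrow> 'a) set set"
  assume *: "\<forall>K\<in>\<K>. K \<subseteq> affine_space n \<and> algebraic_set n (affine_space n - K)"
  then show "\<Union>\<K> \<subseteq> affine_space n" by blast
  have "algebraic_set n (affine_space n \<inter> \<Inter>((\<lambda>K. affine_space n - K) ` \<K>))"
    by (rule algebraic_set_Inter) (use * in auto)
  also have "affine_space n \<inter> \<Inter>((\<lambda>K. affine_space n - K) ` \<K>) = affine_space n - \<Union>\<K>"
    by blast
  finally show "algebraic_set n (affine_space n - \<Union>\<K>)" .
qed

lemma openin_zariski:
  "openin (zariski n) U \<longleftrightarrow> U \<subseteq> affine_space n \<and> algebraic_set n (affine_space n - U)"
  unfolding zariski_def using topology_inverse'[OF istopology_zariski] by metis

lemma topspace_zariski [simp]: "topspace (zariski n) = affine_space n"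
proof -
  have "algebraic_set n ({} :: (nat \<Rightarrow> 'a) set)"
    unfolding algebraic_set_def
    by (rule exI[of _ "{1}"]) (auto simp: polys_def eval_along_def)
  then have "openin (zariski n) (affine_space n :: (nat \<Rightarrow> 'a) set)"
    by (simp add: openin_zariski)
  then show ?thesis
    by (meson openin_subset openin_topspace openin_zariski subset_antisym)
qed

lemma closedin_zariski: "closedin (zariski n) S \<longleftrightarrow> algebraic_set n S"
proof -
  have "algebraic_set n S \<Longrightarrow> S \<subseteq> affine_space n"
    by (auto simp: algebraic_set_def)
  then show ?thesis
    by (auto simp: closedin_def openin_zariski double_diff)
qed


section \<open>Fundamental and locally fundamental sets\<close>

definition to_ac_point :: "nat \<Rightarrow> (nat \<Rightarrow> 'a::field) \<Rightarrow> (nat \<Rightarrow> 'a alg_closure)" where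
  "to_ac_point n x = (\<lambda>i\<in>{..<n}. to_ac (x i))"

definition ac_closure :: "nat \<Rightarrow> (nat \<Rightarrow> 'a::field) set \<Rightarrow> (nat \<Rightarrow> 'a alg_closure) set" where
  "ac_closure n S = zariski n closure_of (to_ac_point n ` S)"

definition locally_constant :: "'x topology \<Rightarrow> ('x \<Rightarrow> 'y) \<Rightarrow> bool" where
  "locally_constant Tp f \<longleftrightarrow>
     (\<forall>x\<in>topspace Tp. \<exists>U. openin Tp U \<and> x \<in> U \<and> f constant_on U)"

definition fundamental :: "nat \<Rightarrow> (nat \<Rightarrow> 'a::field) set \<Rightarrow> bool" where
  "fundamental n S \<longleftrightarrow>
     (\<forall>f\<in>polys n. \<not> mpoly_eval f constant_on S \<longrightarrow>
        (\<exists>p\<in>ac_closure n S. eval_along to_ac f p = 0))"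

definition locally_fundamental :: "nat \<Rightarrow> (nat \<Rightarrow> 'a::field) set \<Rightarrow> bool" where
  "locally_fundamental n S \<longleftrightarrow>
     (\<forall>f\<in>polys n. \<not> locally_constant (subtopology (zariski n) S) (mpoly_eval f) \<longrightarrow>
        (\<exists>p\<in>ac_closure n S. eval_along to_ac f p = 0))"


section \<open>Algebras over a field\<close>

text \<open>
  A commutative algebra over the field \<open>'a\<close> is a record \<open>A\<close> with \<open>algebra ring_of_type_algebra A\<close>.
\<close>

definition alg_hom ::
    "('a, 'r, 'm) module_scheme \<Rightarrow> ('a, 's, 'n) module_scheme \<Rightarrow> ('r \<Rightarrow> 's) set" where
  "alg_hom A B = {h \<in> ring_hom A B. \<forall>c. \<forall>a\<in>carrier A. h (c \<odot>\<^bsub>A\<^esub> a) = c \<odot>\<^bsub>B\<^esub> h a}"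

definition alg_isomorphic ::
    "('a, 'r, 'm) module_scheme \<Rightarrow> ('a, 's, 'n) module_scheme \<Rightarrow> bool" where
  "alg_isomorphic A B \<longleftrightarrow> (\<exists>h\<in>alg_hom A B. bij_betw h (carrier A) (carrier B))"

definition field_alg :: "('a::field, 'a) module" where
  "field_alg = \<lparr>carrier = UNIV, monoid.mult = (*), one = 1, ring.zero = 0, add = (+), module.smult = (*)\<rparr>"

text \<open>The quotient algebra: the ring \<open>A Quot I\<close> with the induced scalar multiplication.\<close>

definition quot_alg :: "('a, 'r, 'm) module_scheme \<Rightarrow> 'r set \<Rightarrow> ('a, 'r set) module" where
  "quot_alg A I =
     \<lparr>carrier = carrier (A Quot I), monoid.mult = monoid.mult (A Quot I), one = one (A Quot I),
      ring.zero = ring.zero (A Quot I), add = add (A Quot I),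
      module.smult = (\<lambda>c Y. \<Union>a\<in>Y. I +>\<^bsub>A\<^esub> (c \<odot>\<^bsub>A\<^esub> a))\<rparr>"

definition poly_alg :: "nat \<Rightarrow> ('a::field, 'a mpoly) module" where
  "poly_alg n =
     \<lparr>carrier = polys n, monoid.mult = (*), one = 1, ring.zero = 0, add = (+),
      module.smult = (\<lambda>c f. Poly_Mapping.single 0 c * f)\<rparr>"

definition coordinate_ring ::
    "nat \<Rightarrow> (nat \<Rightarrow> 'a::field) set \<Rightarrow> ('a, 'a mpoly set) module" where
  "coordinate_ring n S = quot_alg (poly_alg n) (vanishing_ideal n S)"

subsection \<open>Base change to the algebraic closure\<close>

text \<open>
  \<open>A \<otimes>\<^sub>k k\<^sup>a\<^sup>l\<^sup>g\<close> is the free \<open>k\<^sup>a\<^sup>l\<^sup>g\<close>-module on the elements of \<open>A\<close>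
  (the basis vector of \<open>a\<close> stands for \<open>a \<otimes> 1\<close>), with product extending that of \<open>A\<close>,
  modulo the \<open>k\<close>-linearity relations. The span of these relations is already stable under
  multiplication by basis vectors, so it coincides with the ideal they generate.
\<close>

definition free_alg ::
    "('a, 'r, 'm) module_scheme \<Rightarrow> ('l::field, 'r \<Rightarrow>\<^sub>0 'l) module" where
  "free_alg A =
     \<lparr>carrier = {F. Poly_Mapping.keys F \<subseteq> carrier A},
      monoid.mult = (\<lambda>F G. \<Sum>a\<in>Poly_Mapping.keys F. \<Sum>b\<in>Poly_Mapping.keys G.
        Poly_Mapping.single (a \<otimes>\<^bsub>A\<^esub> b) (Poly_Mapping.lookup F a * Poly_Mapping.lookup G b)),
      one = Poly_Mapping.single \<one>\<^bsub>A\<^esub> 1, ring.zero = 0, add = (+),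
      module.smult = (\<lambda>c. Poly_Mapping.map ((*) c))\<rparr>"

definition linearity_relations ::
    "('a::field, 'r, 'm) module_scheme \<Rightarrow> ('r \<Rightarrow>\<^sub>0 'a alg_closure) set" where
  "linearity_relations A =
     {Poly_Mapping.single (a \<oplus>\<^bsub>A\<^esub> b) 1 - Poly_Mapping.single a 1 - Poly_Mapping.single b 1 | a b.
        a \<in> carrier A \<and> b \<in> carrier A} \<union>
     {Poly_Mapping.single (c \<odot>\<^bsub>A\<^esub> a) 1 - Poly_Mapping.single a (to_ac c) | c a. a \<in> carrier A}"

definition tensor_ideal ::
    "('a::field, 'r, 'm) module_scheme \<Rightarrow> ('r \<Rightarrow>\<^sub>0 'a alg_closure) set" where
  "tensor_ideal A = Idl\<^bsub>free_alg A\<^esub> (linearity_relations A)"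

definition base_change ::
    "('a::field, 'r, 'm) module_scheme \<Rightarrow>
     ('a alg_closure, ('r \<Rightarrow>\<^sub>0 'a alg_closure) set) module" where
  "base_change A = quot_alg (free_alg A) (tensor_ideal A)"

definition tensor_one ::
    "('a::field, 'r, 'm) module_scheme \<Rightarrow> 'r \<Rightarrow> ('r \<Rightarrow>\<^sub>0 'a alg_closure) set" where
  "tensor_one A g = tensor_ideal A +>\<^bsub>free_alg A\<^esub> Poly_Mapping.single g 1"


section \<open>Affine varieties\<close>

text \<open>
  An affine variety \<open>V\<close> over \<open>k\<close> is given by its coordinate ring \<open>A\<close>, a reduced finitely
  generated \<open>k\<close>-algebra (not necessarily a domain); regular functions \<open>V \<rightarrow> \<bbbA>\<^sup>1\<close> are the
  elements of \<open>A\<close>, and isomorphisms of varieties correspond to isomorphisms of \<open>k\<close>-algebras.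
\<close>

definition affine_variety :: "('a::field, 'r, 'm) module_scheme \<Rightarrow> bool" where
  "affine_variety A \<longleftrightarrow>
     algebra (ring_of_type_algebra :: 'a ring) A \<and>
     (\<exists>G. finite G \<and> G \<subseteq> carrier A \<and>
        generate_ring A (G \<union> range (\<lambda>c. c \<odot>\<^bsub>A\<^esub> \<one>\<^bsub>A\<^esub>)) = carrier A) \<and>
     (\<forall>a\<in>carrier A. \<forall>m::nat. a [^]\<^bsub>A\<^esub> m = \<zero>\<^bsub>A\<^esub> \<longrightarrow> a = \<zero>\<^bsub>A\<^esub>)"

definition spectrum :: "('r, 'm) ring_scheme \<Rightarrow> 'r set set" where
  "spectrum A = {P. primeideal P A}"

definition spectrum_topology :: "('r, 'm) ring_scheme \<Rightarrow> 'r set topology" where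
  "spectrum_topology A =
     topology_generated_by ((\<lambda>a. {P \<in> spectrum A. a \<notin> P}) ` carrier A)"

text \<open>
  A regular function takes the value \<open>c \<in> k\<close> at \<open>P\<close> iff it equals \<open>c\<close> in the residue field
  of \<open>P\<close>. As \<open>A\<close> is reduced, this holds for all \<open>P\<close> in an open set \<open>U\<close> iff the restriction of
  the function to \<open>U\<close> is the constant \<open>c\<close>.
\<close>

definition const_on_points ::
    "('a, 'r, 'm) module_scheme \<Rightarrow> 'r \<Rightarrow> 'r set set \<Rightarrow> bool" where
  "const_on_points A g U \<longleftrightarrow> (\<exists>c. \<forall>P\<in>U. g \<ominus>\<^bsub>A\<^esub> (c \<odot>\<^bsub>A\<^esub> \<one>\<^bsub>A\<^esub>) \<in> P)"

definition regular_constant :: "('a, 'r, 'm) module_scheme \<Rightarrow> 'r \<Rightarrow> bool" where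
  "regular_constant A g \<longleftrightarrow> const_on_points A g (spectrum A)"

definition regular_locally_constant :: "('a, 'r, 'm) module_scheme \<Rightarrow> 'r \<Rightarrow> bool" where
  "regular_locally_constant A g \<longleftrightarrow>
     (\<forall>P\<in>spectrum A. \<exists>U. openin (spectrum_topology A) U \<and> P \<in> U \<and> const_on_points A g U)"

text \<open>
  Over the algebraically closed field \<open>k\<^sup>a\<^sup>l\<^sup>g\<close>, the points of a variety are its rational points,
  i.e. the algebra homomorphisms from its coordinate ring to \<open>k\<^sup>a\<^sup>l\<^sup>g\<close>.
\<close>

definition rational_points :: "('l::field, 'r, 'm) module_scheme \<Rightarrow> ('r \<Rightarrow> 'l) set" where
  "rational_points B = alg_hom B field_alg"

definition Gm :: "'l::field set" where
  "Gm = UNIV - {0}"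

text \<open>
  \<open>g \<otimes>\<^sub>k k\<^sup>a\<^sup>l\<^sup>g\<close>, as a map on the points of \<open>V \<otimes>\<^sub>k k\<^sup>a\<^sup>l\<^sup>g\<close>: the comorphism sends the
  coordinate of the affine line to \<open>g \<otimes> 1\<close>.
\<close>

definition base_change_fun ::
    "('a::field, 'r, 'm) module_scheme \<Rightarrow> 'r \<Rightarrow>
     (('r \<Rightarrow>\<^sub>0 'a alg_closure) set \<Rightarrow> 'a alg_closure) \<Rightarrow> 'a alg_closure" where
  "base_change_fun A g = (\<lambda>\<phi>. \<phi> (tensor_one A g))"

definition factors_through_Gm :: "('a::field, 'r, 'm) module_scheme \<Rightarrow> 'r \<Rightarrow> bool" where
  "factors_through_Gm A g \<longleftrightarrow> base_change_fun A g \<in> rational_points (base_change A) \<rightarrow> Gm"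

end

theory Submission
  imports Defs
begin

text \<open>
  An isomorphism from the coordinate ring of \<open>S\<close> to \<open>V\<close> amounts to a surjection \<open>\<pi>\<close> from the
  polynomials onto \<open>V\<close> with kernel \<open>I(S)\<close>. The points of \<open>V \<otimes>\<^sub>k k\<^sup>a\<^sup>l\<^sup>g\<close> are the \<open>k\<close>-algebra
  homomorphisms from \<open>V\<close> to \<open>k\<^sup>a\<^sup>l\<^sup>g\<close>, hence the common zeros of \<open>I(S)\<close> over \<open>k\<^sup>a\<^sup>l\<^sup>g\<close>, hence the points
  of the closure of \<open>S\<close>; so \<open>f\<close> has no zero there iff \<open>\<pi> f\<close> factors through \<open>\<bbbG>\<^sub>m\<close>. Constancy is
  compared through the prime ideals of the points of \<open>S\<close>. A locally constant \<open>f\<close> takes only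
  finitely many values \<open>c\<close> on \<open>S\<close>, since polynomial rings are Noetherian, so the product of
  all \<open>\<pi> f - c\<close> is zero and every prime ideal contains one of the factors.
\<close>

section \<open>Hilbert's basis theorem\<close>

text \<open>Two mismatches shape the argument. The closure of \<open>S\<close> is formed with
  polynomials over \<open>k^alg\<close>, while I(S) has coefficients in k, so a polynomial over
  \<open>k^alg\<close> vanishing on \<open>S\<close> must be shown to impose no condition beyond
  those of I(S). This is linear independence over k: at a point of \<open>S\<close> a polynomial
  over k takes its value in k, so no cancellation between independent coefficients can occur. The
  second mismatch is that (local) constancy on V is tested at all prime ideals, and these need not
  come from points of \<open>S\<close>. For global constancy this is harmless, because zero lies in
  every prime ideal. For local constancy it is a real obstacle: unless k is algebraically closed,
  open sets that contain all points of \<open>S\<close> may fail to cover the spectrum (over the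
  reals, the nonvanishing set of X^2 + 1 contains every point of the line but misses a maximal
  ideal). Local constancy therefore has to be recast as one polynomial identity on all of
  \<open>S\<close>, and such an identity exists only once the set of values is finite. That is the
  purpose of the basis theorem here.\<close>

definition subring_of :: "'a::comm_ring_1 set \<Rightarrow> bool" where
  "subring_of R \<longleftrightarrow> 0 \<in> R \<and> 1 \<in> R \<and>
     (\<forall>a\<in>R. \<forall>b\<in>R. a + b \<in> R \<and> a * b \<in> R) \<and> (\<forall>a\<in>R. - a \<in> R)"

definition ideal_of :: "'a::comm_ring_1 set \<Rightarrow> 'a set \<Rightarrow> bool" where
  "ideal_of R J \<longleftrightarrow> J \<subseteq> R \<and> 0 \<in> J \<and> (\<forall>a\<in>J. \<forall>b\<in>J. a + b \<in> J) \<and> (\<forall>r\<in>R. \<forall>a\<in>J. r * a \<in> J)"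

definition generated_ideal :: "'a::comm_ring_1 set \<Rightarrow> 'a set \<Rightarrow> 'a set" where
  "generated_ideal R A = \<Inter>{J. ideal_of R J \<and> A \<subseteq> J}"

text \<open>The ascending chain condition for ideals generated by initial segments of a sequence,
  the form in which it is applied to leading coefficients and to separating polynomials. Rings are
  carrier sets in one ambient type, so that all \<open>polys n\<close> live in the same type and the
  number of variables can grow by induction.\<close>

definition noetherian :: "'a::comm_ring_1 set \<Rightarrow> bool" where
  "noetherian R \<longleftrightarrow> subring_of R \<and>
     (\<forall>f :: nat \<Rightarrow> 'a. range f \<subseteq> R \<longrightarrow> (\<exists>N. f N \<in> generated_ideal R (f ` {..<N})))"

lemma subring_ofD:
  assumes "subring_of R"
  shows "0 \<in> R" "1 \<in> R" "a \<in> R \<Longrightarrow> b \<in> R \<Longrightarrow> a + b \<in> R" "a \<in> R \<Longrightarrow> b \<in> R \<Longrightarrow> a * b \<in> R"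
    "a \<in> R \<Longrightarrow> - a \<in> R" "a \<in> R \<Longrightarrow> b \<in> R \<Longrightarrow> a - b \<in> R"
proof -
  show "a - b \<in> R" if "a \<in> R" "b \<in> R"
  proof -
    have "a + - b \<in> R" using assms that unfolding subring_of_def by blast
    then show ?thesis by simp
  qed
qed (use assms in \<open>simp_all add: subring_of_def\<close>)

lemma subring_of_sum: "subring_of R \<Longrightarrow> (\<And>i. i \<in> A \<Longrightarrow> f i \<in> R) \<Longrightarrow> sum f A \<in> R"
  by (induction A rule: infinite_finite_induct) (auto simp: subring_ofD)

lemma subring_of_power: "subring_of R \<Longrightarrow> a \<in> R \<Longrightarrow> a ^ k \<in> R"
  by (induction k) (auto simp: subring_ofD)

lemma ideal_ofD:
  assumes "ideal_of R J"
  shows "a \<in> J \<Longrightarrow> a \<in> R" "0 \<in> J" "a \<in> J \<Longrightarrow> b \<in> J \<Longrightarrow> a + b \<in> J" "r \<in> R \<Longrightarrow> a \<in> J \<Longrightarrow> r * a \<in> J"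
  using assms unfolding ideal_of_def by blast+

lemma ideal_of_diff:
  assumes "subring_of R" "ideal_of R J" "a \<in> J" "b \<in> J" shows "a - b \<in> J"
proof -
  have "- 1 \<in> R" using assms(1) by (simp add: subring_ofD)
  then have "a + - 1 * b \<in> J" using assms by (intro ideal_ofD(3,4))
  then show ?thesis by simp
qed

lemma ideal_of_sum: "ideal_of R J \<Longrightarrow> (\<And>i. i \<in> A \<Longrightarrow> f i \<in> J) \<Longrightarrow> sum f A \<in> J"
  by (induction A rule: infinite_finite_induct) (auto simp: ideal_ofD)

lemma generated_ideal_superset: "A \<subseteq> generated_ideal R A"
  by (auto simp: generated_ideal_def)

lemma generated_ideal_minimal: "ideal_of R J \<Longrightarrow> A \<subseteq> J \<Longrightarrow> generated_ideal R A \<subseteq> J"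
  by (auto simp: generated_ideal_def)

lemma generated_ideal_mono: "A \<subseteq> B \<Longrightarrow> generated_ideal R A \<subseteq> generated_ideal R B"
  by (auto simp: generated_ideal_def)

lemma ideal_of_generated:
  assumes "subring_of R" "A \<subseteq> R" shows "ideal_of R (generated_ideal R A)"
proof -
  have "ideal_of R R" using assms by (auto simp: ideal_of_def subring_ofD)
  then have "generated_ideal R A \<subseteq> R" using assms by (intro generated_ideal_minimal)
  then show ?thesis unfolding ideal_of_def by (auto simp: generated_ideal_def ideal_ofD)
qed

text \<open>The combinations form an ideal that contains the generators, so they exhaust the ideal
  defined as an intersection. Explicit coefficients are needed to lift a relation among leading
  coefficients to the elements themselves.\<close>

lemma generated_ideal_image_sum:
  assumes R: "subring_of R" "f ` {..<N::nat} \<subseteq> R" and a: "a \<in> generated_ideal R (f ` {..<N})"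
  obtains r where "\<And>i. r i \<in> R" "a = (\<Sum>i<N. r i * f i)"
proof -
  let ?J = "{\<Sum>i<N. r i * f i | r. \<forall>i. r i \<in> R}"
  have "ideal_of R ?J"
    unfolding ideal_of_def
  proof (intro conjI ballI)
    show "?J \<subseteq> R" using R by (auto intro!: subring_of_sum subring_ofD(4))
    show "0 \<in> ?J" using R by (auto intro!: exI[of _ "\<lambda>_. 0"] simp: subring_ofD)
  next
    fix a b assume "a \<in> ?J" "b \<in> ?J"
    then obtain r s where "\<forall>i. r i \<in> R" "\<forall>i. s i \<in> R" "a = (\<Sum>i<N. r i * f i)" "b = (\<Sum>i<N. s i * f i)"
      by auto
    then show "a + b \<in> ?J" using R
      by (auto intro!: exI[of _ "\<lambda>i. r i + s i"] simp: subring_ofD sum.distrib algebra_simps)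
  next
    fix a r assume "r \<in> R" "a \<in> ?J"
    then obtain s where "\<forall>i. s i \<in> R" "a = (\<Sum>i<N. s i * f i)" by auto
    then show "r * a \<in> ?J" using R \<open>r \<in> R\<close>
      by (auto intro!: exI[of _ "\<lambda>i. r * s i"] simp: subring_ofD sum_distrib_left mult.assoc)
  qed
  moreover have "f ` {..<N} \<subseteq> ?J"
  proof
    fix b assume "b \<in> f ` {..<N}"
    then obtain j where j: "j < N" "b = f j" by auto
    \<comment> \<open>The generator \<open>f j\<close> is the combination with indicator
      coefficients.\<close>
    have "(\<Sum>i<N. (if i = j then 1 else 0) * f i) = (\<Sum>i<N. if i = j then f i else 0)"
      by (rule sum.cong) auto
    then have "b = (\<Sum>i<N. (if i = j then 1 else 0) * f i)" using j by simp
    then show "b \<in> ?J" using R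
      by (intro CollectI exI[of _ "\<lambda>i. if i = j then 1 else 0"] conjI) (simp_all add: subring_ofD)
  qed
  ultimately have "a \<in> ?J" using generated_ideal_minimal a by blast
  then show thesis using that by auto
qed

section \<open>The ring R[x] generated by one further element, filtered by length of
  representation\<close>

definition bounded_combinations :: "'a::comm_ring_1 set \<Rightarrow> 'a \<Rightarrow> nat \<Rightarrow> 'a set" where
  "bounded_combinations R x d = {\<Sum>i<d. r i * x ^ i | r. \<forall>i. r i \<in> R}"

definition adjoin :: "'a::comm_ring_1 set \<Rightarrow> 'a \<Rightarrow> 'a set" where
  "adjoin R x = (\<Union>d. bounded_combinations R x d)"

lemma bounded_combinationsI:
  "\<lbrakk>\<And>i. r i \<in> R; a = (\<Sum>i<d. r i * x ^ i)\<rbrakk> \<Longrightarrow> a \<in> bounded_combinations R x d"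
  unfolding bounded_combinations_def by (intro CollectI exI[of _ r] conjI allI)

lemma bounded_combinationsE:
  assumes "a \<in> bounded_combinations R x d"
  obtains r where "\<forall>i. r i \<in> R" "a = (\<Sum>i<d. r i * x ^ i)"
  using assms unfolding bounded_combinations_def mem_Collect_eq by (elim exE conjE) (rule that)

text \<open>Splits off the leading term; the \<open>r\<close> obtained plays the part of a leading
  coefficient, although it depends on the chosen representation.\<close>

lemma bounded_combinations_Suc:
  assumes "a \<in> bounded_combinations R x (Suc d)"
  obtains r where "r \<in> R" "a - r * x ^ d \<in> bounded_combinations R x d"
proof -
  from assms obtain r where r: "\<forall>i. r i \<in> R" "a = (\<Sum>i<Suc d. r i * x ^ i)"
    by (rule bounded_combinationsE)
  then have "a - r d * x ^ d = (\<Sum>i<d. r i * x ^ i)" by simp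
  then have "a - r d * x ^ d \<in> bounded_combinations R x d"
    by (rule bounded_combinationsI[rotated]) (rule r(1)[rule_format])
  with r(1) show thesis by (intro that) auto
qed

lemma bounded_combinations_0: "bounded_combinations R x 0 \<subseteq> {0}"
  by (auto simp: bounded_combinations_def)

context
  fixes R :: "'a::comm_ring_1 set" and x :: 'a
  assumes R: "subring_of R"
begin

lemma bounded_combinations_add:
  assumes "a \<in> bounded_combinations R x d" "b \<in> bounded_combinations R x d"
  shows "a + b \<in> bounded_combinations R x d"
proof -
  obtain r where "\<forall>i. r i \<in> R" "a = (\<Sum>i<d. r i * x ^ i)"
    using assms(1) by (rule bounded_combinationsE)
  moreover obtain s where "\<forall>i. s i \<in> R" "b = (\<Sum>i<d. s i * x ^ i)"
    using assms(2) by (rule bounded_combinationsE)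
  ultimately have "\<forall>i. r i + s i \<in> R" "a + b = (\<Sum>i<d. (r i + s i) * x ^ i)"
    using R by (simp_all add: subring_ofD sum.distrib distrib_right)
  then show ?thesis by (intro bounded_combinationsI[where r = "\<lambda>i. r i + s i"]) auto
qed

lemma bounded_combinations_scale:
  assumes "a \<in> bounded_combinations R x d" "c \<in> R"
  shows "c * a \<in> bounded_combinations R x d"
proof -
  obtain r where "\<forall>i. r i \<in> R" "a = (\<Sum>i<d. r i * x ^ i)"
    using assms(1) by (rule bounded_combinationsE)
  then have "\<forall>i. c * r i \<in> R" "c * a = (\<Sum>i<d. (c * r i) * x ^ i)"
    using R assms(2) by (simp_all add: subring_ofD sum_distrib_left mult.assoc)
  then show ?thesis by (intro bounded_combinationsI[where r = "\<lambda>i. c * r i"]) auto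
qed

lemma bounded_combinations_zero: "0 \<in> bounded_combinations R x d"
  unfolding bounded_combinations_def
  by (intro CollectI exI[of _ "\<lambda>i. 0"]) (simp add: subring_ofD[OF R])

lemma bounded_combinations_diff:
  assumes "a \<in> bounded_combinations R x d" "b \<in> bounded_combinations R x d"
  shows "a - b \<in> bounded_combinations R x d"
  using bounded_combinations_add[OF assms(1) bounded_combinations_scale[OF assms(2), of "- 1"]] R
  by (simp add: subring_ofD)

lemma bounded_combinations_sum:
  "(\<And>i. i \<in> A \<Longrightarrow> f i \<in> bounded_combinations R x d) \<Longrightarrow> sum f A \<in> bounded_combinations R x d"
  by (induction A rule: infinite_finite_induct)
    (auto simp: bounded_combinations_zero bounded_combinations_add)

lemma bounded_combinations_shift:
  assumes "a \<in> bounded_combinations R x d" shows "x ^ k * a \<in> bounded_combinations R x (k + d)"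
proof -
  obtain r where r: "\<forall>i. r i \<in> R" "a = (\<Sum>i<d. r i * x ^ i)"
    using assms(1) by (rule bounded_combinationsE)
  \<comment> \<open>Coefficients of the shifted combination: index \<open>i\<close> moves to
    \<open>i + k\<close>, and the first \<open>k\<close> places are filled with zeros.\<close>
  let ?s = "\<lambda>i. if k \<le> i then r (i - k) else 0"
  have "x ^ k * a = (\<Sum>i<d. ?s (i + k) * x ^ (i + k))"
    by (simp add: r sum_distrib_left power_add mult_ac)
  also have "\<dots> = (\<Sum>i=0+k..<d+k. ?s i * x ^ i)"
    by (simp only: sum.shift_bounds_nat_ivl lessThan_atLeast0)
  also have "\<dots> = (\<Sum>i<k + d. ?s i * x ^ i)"
    by (rule sum.mono_neutral_left) auto
  finally show ?thesis
    by (rule bounded_combinationsI[rotated]) (use r(1) in \<open>simp add: subring_ofD[OF R]\<close>)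
qed

lemma bounded_combinations_mono:
  assumes "d \<le> e" shows "bounded_combinations R x d \<subseteq> bounded_combinations R x e"
proof
  fix a assume "a \<in> bounded_combinations R x d"
  then obtain r where r: "\<forall>i. r i \<in> R" "a = (\<Sum>i<d. r i * x ^ i)"
    by (rule bounded_combinationsE)
  \<comment> \<open>The coefficients \<open>r i\<close> with \<open>i\<close> at least
    \<open>d\<close> are arbitrary elements of \<open>R\<close>, so they are replaced by zero before
    the sum is lengthened.\<close>
  let ?s = "\<lambda>i. if i < d then r i else 0"
  have "a = (\<Sum>i<d. ?s i * x ^ i)" using r by simp
  also have "\<dots> = (\<Sum>i<e. ?s i * x ^ i)"
    by (rule sum.mono_neutral_left) (use assms in auto)
  finally show "a \<in> bounded_combinations R x e"
    by (rule bounded_combinationsI[rotated]) (use r(1) in \<open>simp add: subring_ofD[OF R]\<close>)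
qed

lemma base_subset_adjoin: "R \<subseteq> adjoin R x"
proof
  fix r assume "r \<in> R"
  then have "r \<in> bounded_combinations R x 1"
    unfolding bounded_combinations_def by (intro CollectI exI[of _ "\<lambda>_. r"]) simp
  then show "r \<in> adjoin R x" by (auto simp: adjoin_def)
qed

lemma adjoin_generator: "x \<in> adjoin R x"
proof -
  have "1 \<in> bounded_combinations R x 1"
    unfolding bounded_combinations_def
    by (intro CollectI exI[of _ "\<lambda>_. 1"]) (simp add: subring_ofD[OF R])
  from bounded_combinations_shift[OF this, of 1] show ?thesis by (auto simp: adjoin_def)
qed

text \<open>Closure under products reduces to multiplication by a single term
  \<open>r * x ^ k\<close>, which is a shift followed by a scaling; expanding one factor then gives
  the general case.\<close>

lemma subring_of_adjoin: "subring_of (adjoin R x)"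
proof -
  have add: "a + b \<in> adjoin R x" if ab: "a \<in> adjoin R x" "b \<in> adjoin R x" for a b
  proof -
    obtain d e where "a \<in> bounded_combinations R x d" "b \<in> bounded_combinations R x e"
      using ab by (auto simp: adjoin_def)
    then have "a + b \<in> bounded_combinations R x (max d e)"
      using bounded_combinations_mono[of d "max d e"] bounded_combinations_mono[of e "max d e"]
      by (auto intro!: bounded_combinations_add)
    then show ?thesis by (auto simp: adjoin_def)
  qed
  have scale: "r * x ^ k * b \<in> adjoin R x" if rb: "r \<in> R" "b \<in> adjoin R x" for r k b
  proof -
    obtain d where "b \<in> bounded_combinations R x d" using rb(2) by (auto simp: adjoin_def)
    then have "r * (x ^ k * b) \<in> bounded_combinations R x (k + d)"
      using rb(1) by (intro bounded_combinations_scale bounded_combinations_shift)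
    then show ?thesis by (auto simp: adjoin_def mult.assoc)
  qed
  have "0 \<in> adjoin R x" using base_subset_adjoin R by (auto simp: subring_ofD)
  then have sum: "sum f A \<in> adjoin R x" if "\<And>i. i \<in> A \<Longrightarrow> f i \<in> adjoin R x" for f :: "nat \<Rightarrow> 'a" and A
    using that by (induction A rule: infinite_finite_induct) (auto intro: add)
  have "a * b \<in> adjoin R x" if ab: "a \<in> adjoin R x" "b \<in> adjoin R x" for a b
  proof -
    obtain d where "a \<in> bounded_combinations R x d" using ab(1) by (auto simp: adjoin_def)
    then obtain r where "\<forall>i. r i \<in> R" "a = (\<Sum>i<d. r i * x ^ i)" by (rule bounded_combinationsE)
    then show ?thesis using ab(2) by (auto simp: sum_distrib_right intro!: sum scale)
  qed
  moreover have "- a \<in> adjoin R x" if "a \<in> adjoin R x" for a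
    using scale[of "- 1" a 0] that R by (simp add: subring_ofD)
  ultimately show ?thesis unfolding subring_of_def
    using add \<open>0 \<in> adjoin R x\<close> base_subset_adjoin subring_ofD(2)[OF R] by auto
qed

end

text \<open>
  From an ideal that is not finitely generated one picks elements
  \<open>g k\<close> of least degree outside the ideal of the previous ones; a relation among their leading
  coefficients then yields an element of smaller degree. As \<open>x\<close> need not be
  transcendental, the degree is the least length of a representation.
\<close>

theorem noetherian_adjoin:
  fixes R :: "'a::comm_ring_1 set"
  assumes noeth: "noetherian R"
  shows "noetherian (adjoin R x)"
proof -
  have R: "subring_of R" using noeth by (simp add: noetherian_def)
  define R' where "R' = adjoin R x"
  have R': "subring_of R'" unfolding R'_def by (rule subring_of_adjoin[OF R])
  have RR': "R \<subseteq> R'" "x \<in> R'" unfolding R'_def by (rule base_subset_adjoin[OF R] adjoin_generator[OF R])+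
  let ?M = "bounded_combinations R x"
  \<comment> \<open>One more than the usual degree: the length is 0 only for the zero element, and
    length \<open>Suc e\<close> means leading exponent \<open>e\<close>.\<close>
  define deg where "deg a = (LEAST d. a \<in> ?M d)" for a
  have deg: "a \<in> ?M (deg a)" if "a \<in> R'" for a
    using that unfolding R'_def adjoin_def deg_def by (auto intro: LeastI)
  have deg_le: "deg a \<le> d" if "a \<in> ?M d" for a d
    using that unfolding deg_def by (rule Least_le)
  have "\<exists>N. f N \<in> generated_ideal R' (f ` {..<N})" if f: "range f \<subseteq> R'" for f :: "nat \<Rightarrow> 'a"
  proof (rule ccontr)
    assume *: "\<nexists>N. f N \<in> generated_ideal R' (f ` {..<N})"
    let ?I = "\<lambda>N. generated_ideal R' (f ` {..<N})"
    \<comment> \<open>The union of the chain is an ideal because any two of its elements already lie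
      in a common member.\<close>
    define J where "J = (\<Union>N. ?I N)"
    have I: "ideal_of R' (?I N)" for N
      using f by (intro ideal_of_generated[OF R']) auto
    have I_mono: "?I N \<subseteq> ?I M" if "N \<le> M" for N M
      using that by (intro generated_ideal_mono image_mono) auto
    have J: "ideal_of R' J"
      unfolding ideal_of_def
    proof (intro conjI ballI)
      show "J \<subseteq> R'" using ideal_ofD(1)[OF I] by (auto simp: J_def)
      show "0 \<in> J" using ideal_ofD(2)[OF I] by (auto simp: J_def)
    next
      fix a b assume "a \<in> J" "b \<in> J"
      then obtain N M where "a \<in> ?I N" "b \<in> ?I M" by (auto simp: J_def)
      then have "a \<in> ?I (max N M)" "b \<in> ?I (max N M)"
        using I_mono[of N "max N M"] I_mono[of M "max N M"] by auto
      then have "a + b \<in> ?I (max N M)" by (rule ideal_ofD[OF I])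
      then show "a + b \<in> J" by (auto simp: J_def)
    next
      fix r a assume "r \<in> R'" "a \<in> J"
      then show "r * a \<in> J" using ideal_ofD(4)[OF I] by (auto simp: J_def)
    qed
    \<comment> \<open>Finitely many elements of \<open>J\<close> lie in one \<open>?I N\<close>,
      which by assumption misses \<open>f N\<close>, although \<open>f N\<close> belongs to
      \<open>J\<close>.\<close>
    have not_fg: "\<exists>a\<in>J. a \<notin> generated_ideal R' (g ` {..<k})" if g: "\<And>i. i < k \<Longrightarrow> g i \<in> J"
      for g :: "nat \<Rightarrow> 'a" and k
    proof -
      have "\<exists>N. g ` {..<k} \<subseteq> ?I N" using g
      proof (induction k)
        case (Suc k)
        have "\<exists>N. g ` {..<k} \<subseteq> ?I N" by (rule Suc.IH) (simp add: Suc.prems)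
        moreover have "g k \<in> J" by (simp add: Suc.prems)
        ultimately obtain N M where "g ` {..<k} \<subseteq> ?I N" "g k \<in> ?I M" by (auto simp: J_def)
        then have "g ` {..<Suc k} \<subseteq> ?I (max N M)"
          using I_mono[of N "max N M"] I_mono[of M "max N M"] by (auto simp: lessThan_Suc)
        then show ?case by blast
      qed auto
      then obtain N where "g ` {..<k} \<subseteq> ?I N" by blast
      then have "generated_ideal R' (g ` {..<k}) \<subseteq> ?I N" by (rule generated_ideal_minimal[OF I])
      then have "f N \<notin> generated_ideal R' (g ` {..<k})" using * by blast
      moreover have "f N \<in> ?I (Suc N)" using generated_ideal_superset[of "f ` {..<Suc N}" R'] by auto
      ultimately show ?thesis by (auto simp: J_def)
    qed
    define P where "P g k a \<longleftrightarrow> a \<in> J - generated_ideal R' (g ` {..<k}) \<and>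
      (\<forall>b\<in>J - generated_ideal R' (g ` {..<k}). deg a \<le> deg b)" for g :: "nat \<Rightarrow> 'a" and k a
    \<comment> \<open>Recursive choice of \<open>g\<close>: \<open>P g k\<close> looks only at the
      values of \<open>g\<close> below \<open>k\<close>, and a candidate of least degree exists by
      \<open>not_fg\<close>.\<close>
    have "\<exists>g. \<forall>k. P g k (g k)"
    proof (rule dependent_wellorder_choice[where P = P])
      fix r :: 'a and g h :: "nat \<Rightarrow> 'a" and k
      assume "\<And>i. i < k \<Longrightarrow> g i = h i"
      then have "g ` {..<k} = h ` {..<k}" by (intro image_cong) auto
      then show "P g k r = P h k r" by (simp add: P_def)
    next
      fix k and g :: "nat \<Rightarrow> 'a"
      assume "\<And>i. i < k \<Longrightarrow> P g i (g i)"
      then obtain a where a: "a \<in> J - generated_ideal R' (g ` {..<k})"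
        using not_fg[of k g] by (auto simp: P_def)
      show "\<exists>r. P g k r"
        using ex_has_least_nat[of "\<lambda>a. a \<in> J - generated_ideal R' (g ` {..<k})" a deg, OF a]
        unfolding P_def by blast
    qed
    then obtain g where g: "\<And>k. P g k (g k)" by blast
    let ?G = "\<lambda>k. generated_ideal R' (g ` {..<k})"
    have gJ: "g k \<in> J" for k using g[of k] by (simp add: P_def)
    then have gR': "g k \<in> R'" for k using ideal_ofD(1)[OF J] by blast
    have G: "ideal_of R' (?G k)" for k
      using gR' by (intro ideal_of_generated[OF R']) auto
    \<comment> \<open>For \<open>i \<le> k\<close> the element \<open>g k\<close> also lies outside
      the smaller ideal \<open>?G i\<close>, so it competed when \<open>g i\<close> was chosen with
      least degree.\<close>
    have deg_mono: "deg (g i) \<le> deg (g k)" if "i \<le> k" for i k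
    proof -
      have "?G i \<subseteq> ?G k" using that by (intro generated_ideal_mono image_mono) auto
      then show ?thesis using g[of i] g[of k] unfolding P_def by blast
    qed
    \<comment> \<open>Since zero lies in \<open>?G k\<close>, the element \<open>g k\<close> is
      nonzero; its degree is thus a successor and a leading term can be split off.\<close>
    have "\<exists>e r. deg (g k) = Suc e \<and> r \<in> R \<and> g k - r * x ^ e \<in> ?M e" for k
    proof -
      have "g k \<noteq> 0" using g[of k] ideal_ofD(2)[OF G[of k]] by (auto simp: P_def)
      then obtain e where e: "deg (g k) = Suc e"
        using deg[OF gR'[of k]] bounded_combinations_0[of R x] by (cases "deg (g k)") auto
      then show ?thesis using deg[OF gR'[of k]] bounded_combinations_Suc by metis
    qed
    then obtain e r where er: "\<And>k. deg (g k) = Suc (e k)" "\<And>k. r k \<in> R"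
        "\<And>k. g k - r k * x ^ e k \<in> ?M (e k)"
      by metis
    obtain N where "r N \<in> generated_ideal R (r ` {..<N})"
      using noeth er(2) unfolding noetherian_def by blast
    then obtain s where s: "\<And>i. s i \<in> R" "r N = (\<Sum>i<N. s i * r i)"
      using generated_ideal_image_sum[OF R, of r N "r N"] er(2) by blast
    have e_mono: "e i \<le> e N" if "i < N" for i using deg_mono[of i N] that by (simp add: er)
    \<comment> \<open>The relation among the leading coefficients, lifted: each earlier
      \<open>g i\<close> is multiplied by a power of \<open>x\<close> so that its leading exponent
      becomes \<open>e N\<close>, which makes the leading coefficient of \<open>b\<close> equal to
      \<open>r N\<close>.\<close>
    define b where "b = (\<Sum>i<N. s i * x ^ (e N - e i) * g i)"
    have "b \<in> ?G N" unfolding b_def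
    proof (rule ideal_of_sum[OF G])
      fix i assume "i \<in> {..<N}"
      then have "g i \<in> ?G N" using generated_ideal_superset[of "g ` {..<N}" R'] by auto
      moreover have "s i * x ^ (e N - e i) \<in> R'"
        using s(1) RR' by (auto intro!: subring_ofD(4)[OF R'] subring_of_power[OF R'])
      ultimately show "s i * x ^ (e N - e i) * g i \<in> ?G N" by (rule ideal_ofD(4)[OF G, rotated])
    qed
    then have "g N - b \<notin> ?G N"
      using g[of N] ideal_ofD(3)[OF G, of "g N - b" N b] by (auto simp: P_def)
    moreover have "?G N \<subseteq> J" using gJ by (intro generated_ideal_minimal[OF J]) auto
    then have "g N - b \<in> J" using \<open>b \<in> ?G N\<close> gJ by (intro ideal_of_diff[OF R' J]) auto
    \<comment> \<open>Subtracting \<open>b\<close> from \<open>g N\<close> stays in \<open>J\<close>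
      and outside \<open>?G N\<close>, so minimality of \<open>g N\<close> bounds the degree from
      below; the cancellation of leading terms that follows contradicts this.\<close>
    ultimately have "Suc (e N) \<le> deg (g N - b)" using g[of N] er(1)[of N] unfolding P_def by auto
    moreover have "g N - b \<in> ?M (e N)"
    proof -
      have "r N * x ^ e N = (\<Sum>i<N. s i * x ^ (e N - e i) * (r i * x ^ e i))"
        unfolding s(2) sum_distrib_right
      proof (rule sum.cong)
        fix i assume "i \<in> {..<N}"
        then have "x ^ e N = x ^ (e N - e i) * x ^ e i"
          using e_mono by (simp flip: power_add)
        then show "s i * r i * x ^ e N = s i * x ^ (e N - e i) * (r i * x ^ e i)"
          by (simp add: mult_ac)
      qed simp
      then have "g N - b = (g N - r N * x ^ e N) -
          (\<Sum>i<N. s i * (x ^ (e N - e i) * (g i - r i * x ^ e i)))"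
        by (simp add: b_def sum_subtractf right_diff_distrib mult.assoc)
      also have "\<dots> \<in> ?M (e N)"
      proof (rule bounded_combinations_diff[OF R er(3) bounded_combinations_sum[OF R]])
        fix i assume "i \<in> {..<N}"
        then have "x ^ (e N - e i) * (g i - r i * x ^ e i) \<in> ?M (e N)"
          using bounded_combinations_shift[OF R er(3)[of i], of "e N - e i"] e_mono by simp
        then show "s i * (x ^ (e N - e i) * (g i - r i * x ^ e i)) \<in> ?M (e N)"
          using s(1) by (rule bounded_combinations_scale[OF R])
      qed
      finally show ?thesis .
    qed
    then have "deg (g N - b) \<le> e N" by (rule deg_le)
    ultimately show False by simp
  qed
  then show ?thesis using R' unfolding noetherian_def R'_def by blast
qed


section \<open>Polynomials over \<open>k\<close> and their zeros over \<open>k\<^sup>a\<^sup>l\<^sup>g\<close>\<close>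

abbreviation mvar :: "nat \<Rightarrow> 'a::comm_ring_1 mpoly" where
  "mvar i \<equiv> Poly_Mapping.single (Poly_Mapping.single i (Suc 0)) 1"

abbreviation mconst :: "'a::comm_ring_1 \<Rightarrow> 'a mpoly" where
  "mconst \<equiv> Poly_Mapping.single 0"

lemma mvar_power:
  "(mvar i :: 'a::comm_ring_1 mpoly) ^ k = Poly_Mapping.single (Poly_Mapping.single i k) 1"
  by (induction k) (auto simp: mult_single simp flip: single_add)

lemma polys_single:
  "Poly_Mapping.keys m \<subseteq> {..<n} \<Longrightarrow> Poly_Mapping.single m c \<in> polys n"
  by (simp add: polys_def)

lemma mconst_in_polys [simp]: "mconst c \<in> polys n"
  by (simp add: polys_def)

lemma zero_one_in_polys [simp]: "0 \<in> polys n" "1 \<in> polys n"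
  by (simp_all add: polys_def)

lemma mvar_in_polys: "i < n \<Longrightarrow> mvar i \<in> polys n"
  by (auto simp: polys_def)

lemma polys_uminus:
  fixes f :: "'a::comm_ring_1 mpoly"
  assumes "f \<in> polys n" shows "- f \<in> polys n"
  using polys_mult[OF mconst_in_polys[of "- 1"] assms] by (simp add: single_uminus)

lemma subring_of_polys: "subring_of (polys n :: 'a::comm_ring_1 mpoly set)"
  by (simp add: subring_of_def polys_add polys_mult polys_uminus)

lemma polys_Suc: "polys (Suc n) = adjoin (polys n :: 'a::comm_ring_1 mpoly set) (mvar n)"
proof
  note A = subring_of_adjoin[OF subring_of_polys, of n "mvar n"]
  show "polys (Suc n) \<subseteq> adjoin (polys n :: 'a mpoly set) (mvar n)"
  proof
    fix f :: "'a mpoly" assume f: "f \<in> polys (Suc n)"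
    have "Poly_Mapping.single m (Poly_Mapping.lookup f m) \<in> adjoin (polys n) (mvar n)"
      if m: "m \<in> Poly_Mapping.keys f" for m
    proof -
      let ?c = "Poly_Mapping.lookup f m"
      \<comment> \<open>The part of the monomial free of variable \<open>n\<close>; the removed
        power is restored as a power of \<open>mvar n\<close>.\<close>
      define m' where "m' = m - Poly_Mapping.single n (Poly_Mapping.lookup m n)"
      have "m' + Poly_Mapping.single n (Poly_Mapping.lookup m n) = m"
        by (rule poly_mapping_eqI) (auto simp: m'_def lookup_add lookup_minus lookup_single when_def)
      then have "Poly_Mapping.single m ?c =
          Poly_Mapping.single m' ?c * mvar n ^ Poly_Mapping.lookup m n"
        by (simp add: mvar_power mult_single del: One_nat_def)
      moreover have "Poly_Mapping.keys m' \<subseteq> {..<n}"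
      proof
        fix i assume "i \<in> Poly_Mapping.keys m'"
        then have "Poly_Mapping.lookup m' i \<noteq> 0" by (simp add: in_keys_iff)
        then have "i \<noteq> n" "i \<in> Poly_Mapping.keys m"
          by (auto simp: m'_def lookup_minus lookup_single when_def in_keys_iff split: if_splits)
        then show "i \<in> {..<n}" using f m by (force simp: polys_def)
      qed
      then have "Poly_Mapping.single m' ?c \<in> adjoin (polys n) (mvar n)"
        using polys_single base_subset_adjoin[OF subring_of_polys] by blast
      ultimately show ?thesis
        using subring_ofD(4)[OF A] subring_of_power[OF A] adjoin_generator[OF subring_of_polys] by metis
    qed
    then have "(\<Sum>m\<in>Poly_Mapping.keys f. Poly_Mapping.single m (Poly_Mapping.lookup f m))
        \<in> adjoin (polys n) (mvar n)"
      by (rule subring_of_sum[OF A])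
    then show "f \<in> adjoin (polys n) (mvar n)" by (simp add: mpoly_decompose)
  qed
  note P = subring_of_polys[of "Suc n"]
  show "adjoin (polys n :: 'a mpoly set) (mvar n) \<subseteq> polys (Suc n)"
  proof
    fix f :: "'a mpoly" assume "f \<in> adjoin (polys n) (mvar n)"
    then obtain d where "f \<in> bounded_combinations (polys n) (mvar n) d" by (auto simp: adjoin_def)
    then obtain r where r: "\<forall>i. r i \<in> polys n" "f = (\<Sum>i<d. r i * mvar n ^ i)"
      by (rule bounded_combinationsE)
    have "r i * mvar n ^ i \<in> polys (Suc n)" for i
    proof (rule subring_ofD(4)[OF P])
      show "r i \<in> polys (Suc n)" using r(1)[rule_format, of i] by (fastforce simp: polys_def)
      show "mvar n ^ i \<in> polys (Suc n)"
        by (rule subring_of_power[OF P]) (simp add: mvar_in_polys)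
    qed
    then show "f \<in> polys (Suc n)" unfolding r(2) by (rule subring_of_sum[OF P])
  qed
qed

lemma polys_0: "f \<in> polys 0 \<Longrightarrow> \<exists>c. f = mconst c"
proof
  assume "f \<in> polys 0"
  then have "Poly_Mapping.keys f \<subseteq> {0}" by (auto simp: polys_def)
  then show "f = mconst (Poly_Mapping.lookup f 0)"
    by (intro poly_mapping_eqI) (auto simp: lookup_single when_def in_keys_iff)
qed

lemma noetherian_polys: "noetherian (polys n :: 'a::field mpoly set)"
proof (induction n)
  case 0
  have "\<exists>N. f N \<in> generated_ideal (polys 0) (f ` {..<N})" if f: "range f \<subseteq> polys 0"
    for f :: "nat \<Rightarrow> 'a mpoly"
  proof -
    have "\<forall>i. \<exists>c. f i = mconst c" using f polys_0 by blast
    then obtain c where c: "\<And>i. f i = mconst (c i)" by metis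
    show ?thesis
    \<comment> \<open>Over a field the sequence stops at once: either \<open>f 0\<close> is zero and
      lies in the ideal of the empty set, or it is a unit and \<open>f 1\<close> is a multiple of
      it.\<close>
    proof (cases "c 0 = 0")
      case True
      then have "f 0 \<in> generated_ideal (polys 0) (f ` {..<0})"
        using ideal_ofD(2)[OF ideal_of_generated[OF subring_of_polys, of "{}"]] by (simp add: c)
      then show ?thesis ..
    next
      case False
      have I: "ideal_of (polys 0) (generated_ideal (polys 0) (f ` {..<1}))"
        using f by (intro ideal_of_generated[OF subring_of_polys]) auto
      have "f 0 \<in> generated_ideal (polys 0) (f ` {..<1})"
        using generated_ideal_superset[of "f ` {..<1}" "polys 0"] by auto
      then have "mconst (c 1 / c 0) * f 0 \<in> generated_ideal (polys 0) (f ` {..<1})"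
        by (rule ideal_ofD(4)[OF I mconst_in_polys])
      then have "f 1 \<in> generated_ideal (polys 0) (f ` {..<1})"
        using False by (simp add: c mult_single)
      then show ?thesis ..
    qed
  qed
  then show ?case by (auto simp: noetherian_def subring_of_polys)
next
  case (Suc n)
  then show ?case unfolding polys_Suc by (rule noetherian_adjoin)
qed

section \<open>Evaluation over k, and basic open sets of the Zariski topology\<close>

lemma mpoly_eval_mconst [simp]: "mpoly_eval (mconst c) x = c"
  by (simp add: mpoly_eval_single)

lemma mpoly_eval_one [simp]: "mpoly_eval 1 x = (1 :: 'a::comm_ring_1)"
  using mpoly_eval_mconst[of 1 x] by simp

lemma mpoly_eval_uminus [simp]:
  fixes f :: "'a::comm_ring_1 mpoly" shows "mpoly_eval (- f) x = - mpoly_eval f x"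
  using mpoly_eval_add[of f "- f" x] by (simp add: eq_neg_iff_add_eq_0 add.commute)

lemma mpoly_eval_diff:
  fixes f g :: "'a::comm_ring_1 mpoly"
  shows "mpoly_eval (f - g) x = mpoly_eval f x - mpoly_eval g x"
  using mpoly_eval_add[of f "- g" x] by simp

lemma algebraic_set_subset: "algebraic_set n S \<Longrightarrow> S \<subseteq> affine_space n"
  by (auto simp: algebraic_set_def)

lemma topspace_subtopology_zariski:
  "algebraic_set n S \<Longrightarrow> topspace (subtopology (zariski n) S) = S"
  using algebraic_set_subset by auto

text \<open>Nonvanishing sets of single polynomials form a basis: among the equations of the closed
  complement, one must fail at \<open>x\<close>.\<close>

lemma zariski_nbhd:
  assumes "openin (subtopology (zariski n) S) U" "x \<in> U"
  obtains h where "h \<in> polys n" "mpoly_eval h x \<noteq> 0"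
    "\<And>y. y \<in> S \<Longrightarrow> y \<in> affine_space n \<Longrightarrow> mpoly_eval h y \<noteq> 0 \<Longrightarrow> y \<in> U"
proof -
  obtain T where T: "openin (zariski n) T" "U = T \<inter> S"
    using assms(1) by (auto simp: openin_subtopology)
  then obtain P where P: "P \<subseteq> polys n"
      "affine_space n - T = {x \<in> affine_space n. \<forall>f\<in>P. mpoly_eval f x = 0}"
    by (auto simp: openin_zariski algebraic_set_def)
  have "x \<in> affine_space n" "x \<in> T" using T assms(2) by (auto simp: openin_zariski)
  then obtain h where h: "h \<in> P" "mpoly_eval h x \<noteq> 0" using P(2) by blast
  then have "y \<in> U" if "y \<in> S" "y \<in> affine_space n" "mpoly_eval h y \<noteq> 0" for y
    using that P(2) T(2) by blast
  then show thesis using that h P(1) by blast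
qed

lemma openin_basic_zariski:
  assumes S: "algebraic_set n S" and h: "h \<in> polys n"
  shows "openin (subtopology (zariski n) S) {x \<in> S. mpoly_eval h x \<noteq> 0}"
proof -
  have "algebraic_set n {x \<in> affine_space n. mpoly_eval h x = 0}"
    unfolding algebraic_set_def using h by (intro exI[of _ "{h}"]) auto
  moreover have "affine_space n - {x \<in> affine_space n. mpoly_eval h x \<noteq> 0} =
      {x \<in> affine_space n. mpoly_eval h x = 0}" by auto
  ultimately have "openin (zariski n) {x \<in> affine_space n. mpoly_eval h x \<noteq> 0}"
    by (simp add: openin_zariski)
  moreover have "{x \<in> S. mpoly_eval h x \<noteq> 0} = {x \<in> affine_space n. mpoly_eval h x \<noteq> 0} \<inter> S"
    using algebraic_set_subset[OF S] by auto
  ultimately show ?thesis by (auto simp: openin_subtopology)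
qed

text \<open>
  For infinitely many values \<open>c i\<close>, taken at \<open>x i\<close>, separating polynomials \<open>h i\<close> satisfy
  \<open>h i (x j) = 0\<close> iff \<open>i \<noteq> j\<close>, so no \<open>h N\<close> lies in the ideal of the previous ones.
\<close>

lemma locally_constant_finite_range:
  fixes S :: "(nat \<Rightarrow> 'a::field) set"
  assumes S: "algebraic_set n S"
    and lc: "locally_constant (subtopology (zariski n) S) (mpoly_eval f)"
  shows "finite (mpoly_eval f ` S)"
proof (rule ccontr)
  assume "infinite (mpoly_eval f ` S)"
  then obtain c :: "nat \<Rightarrow> 'a" where c: "inj c" "range c \<subseteq> mpoly_eval f ` S"
    using infinite_countable_subset by blast
  then have "\<forall>i. \<exists>x\<in>S. mpoly_eval f x = c i" by (metis imageE range_subsetD)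
  then obtain x where x: "\<And>i. x i \<in> S" "\<And>i. mpoly_eval f (x i) = c i" by metis
  have "\<exists>h\<in>polys n. mpoly_eval h (x i) \<noteq> 0 \<and> (\<forall>y\<in>S. mpoly_eval h y \<noteq> 0 \<longrightarrow> mpoly_eval f y = c i)"
    for i
  proof -
    obtain U where U: "openin (subtopology (zariski n) S) U" "x i \<in> U" "mpoly_eval f constant_on U"
      using lc x(1)[of i] unfolding locally_constant_def topspace_subtopology_zariski[OF S] by blast
    then have "mpoly_eval f y = c i" if "y \<in> U" for y
      using that x(2)[of i] by (metis constant_on_def)
    then show ?thesis
      using zariski_nbhd[OF U(1,2)] algebraic_set_subset[OF S] by (metis subsetD)
  qed
  then obtain h where h: "\<And>i. h i \<in> polys n" "\<And>i. mpoly_eval (h i) (x i) \<noteq> 0"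
      "\<And>i y. y \<in> S \<Longrightarrow> mpoly_eval (h i) y \<noteq> 0 \<Longrightarrow> mpoly_eval f y = c i"
    by metis
  obtain N where N: "h N \<in> generated_ideal (polys n) (h ` {..<N})"
    using noetherian_polys[of n] h(1) unfolding noetherian_def by blast
  \<comment> \<open>The ideal of the single point \<open>x N\<close>: it contains every earlier
    \<open>h i\<close>, since \<open>c\<close> is injective, but not \<open>h N\<close>.\<close>
  let ?J = "{g \<in> polys n. mpoly_eval g (x N) = 0}"
  have "ideal_of (polys n) ?J"
    by (auto simp: ideal_of_def polys_add polys_mult mpoly_eval_add mpoly_eval_mult)
  moreover have "h i \<in> ?J" if "i < N" for i
  proof -
    have "mpoly_eval (h i) (x N) = 0"
    proof (rule ccontr)
      assume "mpoly_eval (h i) (x N) \<noteq> 0"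
      then have "c i = c N" using h(3)[OF x(1), of i N] x(2)[of N] by simp
      then show False using injD[OF c(1), of i N] that by simp
    qed
    then show ?thesis using h(1) by simp
  qed
  ultimately have "h N \<in> ?J" using N generated_ideal_minimal[of "polys n" ?J "h ` {..<N}"] by auto
  then show False using h(2) by auto
qed

section \<open>Evaluation over \<open>k^alg\<close> and the equations of the closure of
  \<open>S\<close>\<close>

lemma eval_to_ac_add: "eval_along to_ac (f + g) x = eval_along to_ac f x + eval_along to_ac g x"
proof -
  let ?A = "Poly_Mapping.keys f \<union> Poly_Mapping.keys g"
  have A: "finite ?A" "Poly_Mapping.keys (f + g) \<subseteq> ?A"
    using Poly_Mapping.keys_add[of f g] by auto
  show ?thesis
    using A by (simp add: eval_along_superset[of ?A] lookup_add algebra_simps sum.distrib)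
qed

lemma eval_to_ac_zero [simp]: "eval_along to_ac 0 x = 0"
  by (simp add: eval_along_def)

lemma eval_to_ac_sum: "eval_along to_ac (\<Sum>a\<in>A. F a) x = (\<Sum>a\<in>A. eval_along to_ac (F a) x)"
  by (induction A rule: infinite_finite_induct) (auto simp: eval_to_ac_add)

lemma eval_to_ac_single:
  "eval_along to_ac (Poly_Mapping.single m c) x =
     to_ac c * (\<Prod>i\<in>Poly_Mapping.keys m. x i ^ Poly_Mapping.lookup m i)"
  by (cases "c = 0") (auto simp: eval_along_def)

lemma eval_to_ac_mconst [simp]: "eval_along to_ac (mconst c) x = to_ac c"
  by (simp add: eval_to_ac_single)

lemma eval_to_ac_one [simp]: "eval_along to_ac 1 x = 1"
  using eval_to_ac_mconst[of 1 x] by (simp del: eval_to_ac_mconst)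

lemma eval_to_ac_mvar [simp]: "eval_along to_ac (mvar i) x = x i"
  by (simp add: eval_to_ac_single)

lemma eval_to_ac_mult:
  "eval_along to_ac (f * g) x = eval_along to_ac f x * eval_along to_ac g x"
proof -
  have "f * g = (\<Sum>a\<in>Poly_Mapping.keys f. Poly_Mapping.single a (Poly_Mapping.lookup f a)) *
                (\<Sum>b\<in>Poly_Mapping.keys g. Poly_Mapping.single b (Poly_Mapping.lookup g b))"
    by (simp add: mpoly_decompose)
  also have "eval_along to_ac \<dots> x = eval_along to_ac f x * eval_along to_ac g x"
    by (simp add: sum_product mult_single eval_to_ac_sum eval_to_ac_single monom_eval_add)
      (simp add: eval_along_def sum_product mult_ac)
  finally show ?thesis .
qed

lemma eval_along_cong_vars:
  assumes "f \<in> polys n" "\<And>i. i < n \<Longrightarrow> x i = y i"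
  shows "eval_along h f x = eval_along h f y"
proof -
  have "(\<Prod>i\<in>Poly_Mapping.keys m. x i ^ Poly_Mapping.lookup m i) =
      (\<Prod>i\<in>Poly_Mapping.keys m. y i ^ Poly_Mapping.lookup m i)" if "m \<in> Poly_Mapping.keys f" for m
  proof (rule prod.cong)
    fix i assume "i \<in> Poly_Mapping.keys m"
    then have "i < n" using assms(1) that by (auto simp: polys_def)
    then show "x i ^ Poly_Mapping.lookup m i = y i ^ Poly_Mapping.lookup m i" by (simp add: assms)
  qed simp
  then show ?thesis unfolding eval_along_def by (intro sum.cong) auto
qed

lemma eval_to_ac_point:
  assumes "f \<in> polys n"
  shows "eval_along to_ac f (to_ac_point n x) = to_ac (mpoly_eval f x)"
proof -
  have "eval_along to_ac f (to_ac_point n x) = eval_along to_ac f (\<lambda>i. to_ac (x i))"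
    using assms by (rule eval_along_cong_vars) (simp add: to_ac_point_def)
  then show ?thesis by (simp add: eval_along_def to_ac_sum to_ac_prod)
qed

lemma to_ac_point_in_affine_space: "to_ac_point n x \<in> affine_space n"
  unfolding to_ac_point_def affine_space_def by (rule restrict_PiE_iff[THEN iffD2]) simp

text \<open>
  A polynomial over \<open>k\<^sup>a\<^sup>l\<^sup>g\<close> is expanded along a \<open>k\<close>-basis of the span of its coefficients.
\<close>

lemma vanishing_on_to_ac_points:
  fixes S :: "(nat \<Rightarrow> 'a::field) set" and F :: "'a alg_closure mpoly"
  assumes F: "F \<in> polys n" "\<And>x. x \<in> S \<Longrightarrow> mpoly_eval F (to_ac_point n x) = 0"
    and p: "\<And>f. f \<in> vanishing_ideal n S \<Longrightarrow> eval_along to_ac f p = 0"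
  shows "mpoly_eval F p = 0"
proof -
  interpret vs: vector_space "\<lambda>(c::'a) (z::'a alg_closure). to_ac c * z"
    by unfold_locales (simp_all add: algebra_simps)
  obtain B where B: "B \<subseteq> Poly_Mapping.lookup F ` Poly_Mapping.keys F" "vs.independent B"
      "Poly_Mapping.lookup F ` Poly_Mapping.keys F \<subseteq> vs.span B"
    using vs.maximal_independent_subset by blast
  have finB: "finite B" using B(1) by (rule finite_subset) simp
  have "\<exists>r. Poly_Mapping.lookup F m = (\<Sum>b\<in>B. to_ac (r b) * b)" for m
  proof (cases "m \<in> Poly_Mapping.keys F")
    case True
    then show ?thesis using B(3) unfolding vs.span_finite[OF finB] by auto
  next
    case False
    then show ?thesis by (intro exI[of _ "\<lambda>_. 0"]) (simp add: in_keys_iff)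
  qed
  then obtain r where r: "\<And>m. Poly_Mapping.lookup F m = (\<Sum>b\<in>B. to_ac (r m b) * b)" by metis
  \<comment> \<open>The component of \<open>F\<close> along the basis element \<open>b\<close>, a
    polynomial with coefficients in k.\<close>
  define f where "f b = (\<Sum>m\<in>Poly_Mapping.keys F. Poly_Mapping.single m (r m b))" for b
  have f: "f b \<in> polys n" for b
    unfolding f_def using F(1)
    by (intro subring_of_sum[OF subring_of_polys] polys_single) (auto simp: polys_def)
  have expand: "mpoly_eval F y = (\<Sum>b\<in>B. eval_along to_ac (f b) y * b)" for y
  proof -
    have "mpoly_eval F y = (\<Sum>m\<in>Poly_Mapping.keys F. \<Sum>b\<in>B. to_ac (r m b) * b *
        (\<Prod>i\<in>Poly_Mapping.keys m. y i ^ Poly_Mapping.lookup m i))"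
      unfolding eval_along_def by (subst r) (simp add: sum_distrib_right)
    also have "\<dots> = (\<Sum>b\<in>B. \<Sum>m\<in>Poly_Mapping.keys F. to_ac (r m b) * b *
        (\<Prod>i\<in>Poly_Mapping.keys m. y i ^ Poly_Mapping.lookup m i))"
      by (rule sum.swap)
    also have "\<dots> = (\<Sum>b\<in>B. eval_along to_ac (f b) y * b)"
      by (simp add: f_def eval_to_ac_sum eval_to_ac_single sum_distrib_left mult_ac)
    finally show ?thesis .
  qed
  have "f b \<in> vanishing_ideal n S" if b: "b \<in> B" for b
  proof -
    have "mpoly_eval (f b) x = 0" if "x \<in> S" for x
    proof -
      \<comment> \<open>At a point of \<open>S\<close> the values of all \<open>f b\<close> lie in
        k, so the vanishing of \<open>F\<close> there is a k-linear relation on the independent set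
        \<open>B\<close> and each value is zero.\<close>
      have "(\<Sum>b\<in>B. to_ac (mpoly_eval (f b) x) * b) = 0"
        using F(2)[OF that] by (simp add: expand eval_to_ac_point[OF f])
      then show ?thesis
        by (rule vs.independentD[OF B(2) finB subset_refl _ b])
    qed
    then show ?thesis using f by (simp add: vanishing_ideal_def)
  qed
  then show ?thesis by (simp add: expand p)
qed

text \<open>The zero set of I(S) over \<open>k^alg\<close> is closed and contains the image of
  \<open>S\<close>, hence contains the closure. Conversely, each equation of the closure vanishes on
  the image of \<open>S\<close>, and \<open>vanishing_on_to_ac_points\<close> carries it over to
  every common zero of I(S).\<close>

lemma ac_closure_iff:
  fixes S :: "(nat \<Rightarrow> 'a::field) set"
  shows "p \<in> ac_closure n S \<longleftrightarrow>
    p \<in> affine_space n \<and> (\<forall>f\<in>vanishing_ideal n S. eval_along to_ac f p = 0)"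
proof
  let ?Z = "{p \<in> affine_space n. \<forall>f\<in>vanishing_ideal n S. eval_along to_ac f p = 0}"
  have map_eval: "mpoly_eval (Poly_Mapping.map to_ac f) p = eval_along to_ac f p" for f :: "'a mpoly" and p
  proof -
    have "Poly_Mapping.lookup (Poly_Mapping.map to_ac f) m = to_ac (Poly_Mapping.lookup f m)" for m
      by (simp add: Poly_Mapping.map.rep_eq when_def)
    moreover from this have "Poly_Mapping.keys (Poly_Mapping.map to_ac f) = Poly_Mapping.keys f"
      by (auto simp: in_keys_iff)
    ultimately show ?thesis by (simp add: eval_along_def)
  qed
  have map_polys: "Poly_Mapping.map to_ac ` vanishing_ideal n S \<subseteq> polys n"
  proof
    fix F assume "F \<in> Poly_Mapping.map to_ac ` vanishing_ideal n S"
    then obtain f where f: "F = Poly_Mapping.map to_ac f" "f \<in> polys n"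
      by (auto simp: vanishing_ideal_def)
    have "Poly_Mapping.keys F \<subseteq> Poly_Mapping.keys f"
      unfolding f(1) by (auto simp: in_keys_iff Poly_Mapping.map.rep_eq)
    with f(2) show "F \<in> polys n" unfolding polys_def by blast
  qed
  have "?Z = {x \<in> affine_space n. \<forall>F\<in>Poly_Mapping.map to_ac ` vanishing_ideal n S. mpoly_eval F x = 0}"
    by (simp add: map_eval)
  with map_polys have Z: "algebraic_set n ?Z" unfolding algebraic_set_def by blast
  have "to_ac_point n ` S \<subseteq> ?Z"
    by (auto simp: vanishing_ideal_def eval_to_ac_point to_ac_point_in_affine_space)
  then have "zariski n closure_of (to_ac_point n ` S) \<subseteq> ?Z"
    using Z by (intro closure_of_minimal) (simp_all add: closedin_zariski)
  then show "p \<in> ac_closure n S \<Longrightarrow>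
    p \<in> affine_space n \<and> (\<forall>f\<in>vanishing_ideal n S. eval_along to_ac f p = 0)"
    unfolding ac_closure_def by blast
next
  assume p: "p \<in> affine_space n \<and> (\<forall>f\<in>vanishing_ideal n S. eval_along to_ac f p = 0)"
  have "algebraic_set n (ac_closure n S)"
    unfolding ac_closure_def closedin_zariski[symmetric] by (rule closedin_closure_of)
  then obtain P where P: "P \<subseteq> polys n"
      "ac_closure n S = {x \<in> affine_space n. \<forall>f\<in>P. mpoly_eval f x = 0}"
    unfolding algebraic_set_def by blast
  have "to_ac_point n ` S \<subseteq> ac_closure n S"
    unfolding ac_closure_def
    by (rule closure_of_subset) (auto simp: to_ac_point_in_affine_space)
  then have vanish: "mpoly_eval F (to_ac_point n x) = 0" if "F \<in> P" "x \<in> S" for F x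
    using that P(2) by blast
  have "mpoly_eval F p = 0" if "F \<in> P" for F
    by (rule vanishing_on_to_ac_points[of F n S]) (use that P(1) p vanish in auto)
  then show "p \<in> ac_closure n S" using p P(2) by blast
qed


section \<open>Points of a base change\<close>

lemma alg_homD:
  assumes "h \<in> alg_hom A B"
  shows "a \<in> carrier A \<Longrightarrow> h a \<in> carrier B" "h \<one>\<^bsub>A\<^esub> = \<one>\<^bsub>B\<^esub>"
    "a \<in> carrier A \<Longrightarrow> b \<in> carrier A \<Longrightarrow> h (a \<oplus>\<^bsub>A\<^esub> b) = h a \<oplus>\<^bsub>B\<^esub> h b"
    "a \<in> carrier A \<Longrightarrow> b \<in> carrier A \<Longrightarrow> h (a \<otimes>\<^bsub>A\<^esub> b) = h a \<otimes>\<^bsub>B\<^esub> h b"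
    "a \<in> carrier A \<Longrightarrow> h (c \<odot>\<^bsub>A\<^esub> a) = c \<odot>\<^bsub>B\<^esub> h a"
  using assms by (auto simp: alg_hom_def ring_hom_def)

lemma alg_homI:
  assumes "\<And>a. a \<in> carrier A \<Longrightarrow> h a \<in> carrier B" "h \<one>\<^bsub>A\<^esub> = \<one>\<^bsub>B\<^esub>"
    "\<And>a b. a \<in> carrier A \<Longrightarrow> b \<in> carrier A \<Longrightarrow> h (a \<oplus>\<^bsub>A\<^esub> b) = h a \<oplus>\<^bsub>B\<^esub> h b"
    "\<And>a b. a \<in> carrier A \<Longrightarrow> b \<in> carrier A \<Longrightarrow> h (a \<otimes>\<^bsub>A\<^esub> b) = h a \<otimes>\<^bsub>B\<^esub> h b"
    "\<And>a c. a \<in> carrier A \<Longrightarrow> h (c \<odot>\<^bsub>A\<^esub> a) = c \<odot>\<^bsub>B\<^esub> h a"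
  shows "h \<in> alg_hom A B"
  using assms by (auto simp: alg_hom_def ring_hom_def)

lemma alg_hom_comp:
  assumes "h \<in> alg_hom A B" "h' \<in> alg_hom B C"
  shows "h' \<circ> h \<in> alg_hom A C"
  by (rule alg_homI) (simp_all add: alg_homD[OF assms(1)] alg_homD[OF assms(2)])

text \<open>Common setting for \<open>poly_alg\<close>, \<open>free_alg\<close> and V, with
  different scalar fields. Scalars act through multiples of the unit, which makes every ring ideal
  stable under scalar multiplication.\<close>

locale unital_alg = ring A for A :: "('a, 'r, 'm) module_scheme" (structure) +
  assumes scalar_closed [simp]: "c \<odot> \<one> \<in> carrier A"
    and smult_eq: "a \<in> carrier A \<Longrightarrow> c \<odot> a = (c \<odot> \<one>) \<otimes> a"
begin

lemma smult_closed [simp]: "a \<in> carrier A \<Longrightarrow> c \<odot> a \<in> carrier A"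
  by (subst smult_eq) auto

lemma smult_add: "a \<in> carrier A \<Longrightarrow> b \<in> carrier A \<Longrightarrow> c \<odot> (a \<oplus> b) = c \<odot> a \<oplus> c \<odot> b"
  by (subst (1 2 3) smult_eq) (auto simp: r_distr)

lemma quot_alg_proj:
  assumes "ideal I A" shows "(+>) I \<in> alg_hom A (quot_alg A I)"
proof -
  interpret I: ideal I A by fact
  \<comment> \<open>Two representatives differ by some \<open>i\<close> in \<open>I\<close>, and
    scaling changes this difference to a multiple of \<open>i\<close>, again in
    \<open>I\<close>.\<close>
  have coset: "I +> (c \<odot> x) = I +> (c \<odot> a)" if a: "a \<in> carrier A" and x: "x \<in> I +> a" for c a x
  proof (rule I.a_repr_independence'[symmetric])
    obtain i where i: "i \<in> I" "x = i \<oplus> a" using x by (auto simp: a_r_coset_def')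
    then have "c \<odot> x = (c \<odot> \<one>) \<otimes> i \<oplus> c \<odot> a"
      using a by (simp add: smult_add smult_eq[of i])
    moreover have "(c \<odot> \<one>) \<otimes> i \<in> I" using i by (intro I.I_l_closed) auto
    ultimately show "c \<odot> x \<in> I +> (c \<odot> a)" by (auto simp: a_r_coset_def')
  qed (use a in simp)
  \<comment> \<open>The scalar multiplication of \<open>quot_alg\<close> is a union over all
    representatives; all its members coincide, and there is at least one.\<close>
  have smult: "(\<Union>x\<in>I +> a. I +> (c \<odot> x)) = I +> (c \<odot> a)" if "a \<in> carrier A" for c a
  proof -
    have "(\<Union>x\<in>I +> a. I +> (c \<odot> x)) = (\<Union>x\<in>I +> a. I +> (c \<odot> a))"
      by (intro SUP_cong refl coset that)
    also have "\<dots> = I +> (c \<odot> a)" using I.a_rcos_self[OF that] by blast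
    finally show ?thesis .
  qed
  have hom: "(+>) I \<in> ring_hom A (quot_alg A I)"
    using I.rcos_ring_hom by (simp add: ring_hom_def quot_alg_def)
  show ?thesis
    unfolding alg_hom_def mem_Collect_eq
  proof (intro conjI hom allI ballI)
    fix c a assume "a \<in> carrier A"
    then show "I +> (c \<odot> a) = c \<odot>\<^bsub>quot_alg A I\<^esub> (I +> a)"
      unfolding quot_alg_def module.simps by (rule smult[symmetric])
  qed
qed

lemma carrier_quot_alg: "ideal I A \<Longrightarrow> carrier (quot_alg A I) = (+>) I ` carrier A"
  by (simp add: quot_alg_def FactRing_def A_RCOSETS_def' image_def) blast

lemma quot_alg_lift:
  fixes B :: "('a, 's, 'n) module_scheme"
  assumes I: "ideal I A" and B: "ring B" and \<chi>: "\<chi> \<in> alg_hom A B" "\<And>a. a \<in> I \<Longrightarrow> \<chi> a = \<zero>\<^bsub>B\<^esub>"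
  obtains \<phi> where "\<phi> \<in> alg_hom (quot_alg A I) B" "\<And>a. a \<in> carrier A \<Longrightarrow> \<phi> (I +> a) = \<chi> a"
proof -
  interpret I: ideal I A by fact
  interpret B: ring B by fact
  \<comment> \<open>Evaluation at an arbitrary representative; the choice does not matter because
    \<open>\<chi>\<close> kills \<open>I\<close>.\<close>
  define \<phi> where "\<phi> C = \<chi> (SOME y. y \<in> C)" for C
  have \<phi>: "\<phi> (I +> a) = \<chi> a" if "a \<in> carrier A" for a
  proof -
    have "(SOME y. y \<in> I +> a) \<in> I +> a" using I.a_rcos_self[OF that] by (rule someI)
    then obtain i where i: "i \<in> I" "(SOME y. y \<in> I +> a) = i \<oplus> a" by (auto simp: a_r_coset_def')
    have "\<phi> (I +> a) = \<chi> i \<oplus>\<^bsub>B\<^esub> \<chi> a"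
      unfolding \<phi>_def i(2) by (rule alg_homD(3)[OF \<chi>(1) I.Icarr[OF i(1)] that])
    then show ?thesis using i(1) alg_homD(1)[OF \<chi>(1) that] by (simp add: \<chi>(2))
  qed
  note proj = alg_homD[OF quot_alg_proj[OF I]] and hom = alg_homD[OF \<chi>(1)]
  have "\<phi> \<in> alg_hom (quot_alg A I) B"
  proof (rule alg_homI; (unfold carrier_quot_alg[OF I])?)
    fix x c assume "x \<in> (+>) I ` carrier A"
    then obtain a where a: "a \<in> carrier A" "x = I +> a" by blast
    then show "\<phi> x \<in> carrier B" by (simp add: \<phi> hom(1))
    show "\<phi> (c \<odot>\<^bsub>quot_alg A I\<^esub> x) = c \<odot>\<^bsub>B\<^esub> \<phi> x"
      using a by (simp add: \<phi> hom(5) proj(5)[symmetric])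
    fix y assume "y \<in> (+>) I ` carrier A"
    then obtain b where b: "b \<in> carrier A" "y = I +> b" by blast
    show "\<phi> (x \<otimes>\<^bsub>quot_alg A I\<^esub> y) = \<phi> x \<otimes>\<^bsub>B\<^esub> \<phi> y"
      using a b by (simp add: \<phi> hom(4) proj(4)[symmetric])
    show "\<phi> (x \<oplus>\<^bsub>quot_alg A I\<^esub> y) = \<phi> x \<oplus>\<^bsub>B\<^esub> \<phi> y"
      using a b by (simp add: \<phi> hom(3) proj(3)[symmetric])
  next
    show "\<phi> \<one>\<^bsub>quot_alg A I\<^esub> = \<one>\<^bsub>B\<^esub>" by (simp add: \<phi> hom(2) flip: proj(2))
  qed
  then show thesis using \<phi> that by blast
qed

end

section \<open>Ring structure of the scalar field and of the free algebra\<close>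

lemma ring_field_alg: "ring (field_alg :: ('l::field, 'l) module)"
proof (intro ringI abelian_groupI monoidI)
  fix x :: 'l
  show "\<exists>y\<in>carrier field_alg. y \<oplus>\<^bsub>field_alg\<^esub> x = \<zero>\<^bsub>field_alg\<^esub>"
    by (rule bexI[of _ "- x"]) (simp_all add: field_alg_def)
qed (simp_all add: field_alg_def algebra_simps)

text \<open>The product is a sum over supports, and these change under addition. Summing over larger
  fixed finite sets makes both distributive laws a matter of comparing coefficients.\<close>

lemma free_alg_mult_superset:
  assumes "finite M" "Poly_Mapping.keys F \<subseteq> M" "finite N" "Poly_Mapping.keys G \<subseteq> N"
  shows "F \<otimes>\<^bsub>free_alg A\<^esub> G = (\<Sum>a\<in>M. \<Sum>b\<in>N.
    Poly_Mapping.single (a \<otimes>\<^bsub>A\<^esub> b) (Poly_Mapping.lookup F a * Poly_Mapping.lookup G b))"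
proof -
  let ?s = "\<lambda>a b. Poly_Mapping.single (a \<otimes>\<^bsub>A\<^esub> b) (Poly_Mapping.lookup F a * Poly_Mapping.lookup G b)"
  have "F \<otimes>\<^bsub>free_alg A\<^esub> G = (\<Sum>a\<in>Poly_Mapping.keys F. \<Sum>b\<in>Poly_Mapping.keys G. ?s a b)"
    by (simp add: free_alg_def)
  also have "\<dots> = (\<Sum>a\<in>Poly_Mapping.keys F. \<Sum>b\<in>N. ?s a b)"
    by (intro sum.cong refl sum.mono_neutral_left) (use assms in \<open>auto simp: in_keys_iff\<close>)
  also have "\<dots> = (\<Sum>a\<in>M. \<Sum>b\<in>N. ?s a b)"
    by (intro sum.mono_neutral_left) (use assms in \<open>auto simp: in_keys_iff\<close>)
  finally show ?thesis .
qed

lemma free_alg_mult_add_left: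
  "(F + G) \<otimes>\<^bsub>free_alg A\<^esub> H = F \<otimes>\<^bsub>free_alg A\<^esub> H + G \<otimes>\<^bsub>free_alg A\<^esub> H"
proof -
  let ?X = "Poly_Mapping.keys F \<union> Poly_Mapping.keys G"
  have X: "finite ?X" "Poly_Mapping.keys (F + G) \<subseteq> ?X" using Poly_Mapping.keys_add[of F G] by auto
  show ?thesis
    using X by (simp add: free_alg_mult_superset[of ?X _ "Poly_Mapping.keys H"] lookup_add
        distrib_right single_add sum.distrib)
qed

lemma free_alg_mult_add_right:
  "H \<otimes>\<^bsub>free_alg A\<^esub> (F + G) = H \<otimes>\<^bsub>free_alg A\<^esub> F + H \<otimes>\<^bsub>free_alg A\<^esub> G"
proof -
  let ?X = "Poly_Mapping.keys F \<union> Poly_Mapping.keys G"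
  have X: "finite ?X" "Poly_Mapping.keys (F + G) \<subseteq> ?X" using Poly_Mapping.keys_add[of F G] by auto
  show ?thesis
    using X by (simp add: free_alg_mult_superset[of "Poly_Mapping.keys H" _ ?X] lookup_add
        distrib_left single_add sum.distrib)
qed

lemma free_alg_mult_zero [simp]: "0 \<otimes>\<^bsub>free_alg A\<^esub> H = 0" "H \<otimes>\<^bsub>free_alg A\<^esub> 0 = 0"
  by (simp_all add: free_alg_def)

lemma free_alg_mult_sum_left:
  "sum F K \<otimes>\<^bsub>free_alg A\<^esub> H = (\<Sum>i\<in>K. F i \<otimes>\<^bsub>free_alg A\<^esub> H)"
  by (induction K rule: infinite_finite_induct) (simp_all add: free_alg_mult_add_left)

lemma free_alg_mult_sum_right:
  "H \<otimes>\<^bsub>free_alg A\<^esub> sum F K = (\<Sum>i\<in>K. H \<otimes>\<^bsub>free_alg A\<^esub> F i)"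
  by (induction K rule: infinite_finite_induct) (simp_all add: free_alg_mult_add_right)

lemma free_alg_mult_single:
  "Poly_Mapping.single a x \<otimes>\<^bsub>free_alg A\<^esub> Poly_Mapping.single b y =
     Poly_Mapping.single (a \<otimes>\<^bsub>A\<^esub> b) (x * y)"
  by (simp add: free_alg_mult_superset[of "{a}" _ "{b}"])

lemma free_alg_mult_assoc:
  fixes A :: "('a, 'r, 'm) module_scheme" (structure)
  assumes A: "ring A" and F: "F \<in> carrier (free_alg A)" and G: "G \<in> carrier (free_alg A)" and H: "H \<in> carrier (free_alg A)"
  shows "(F \<otimes>\<^bsub>free_alg A\<^esub> G) \<otimes>\<^bsub>free_alg A\<^esub> H = F \<otimes>\<^bsub>free_alg A\<^esub> (G \<otimes>\<^bsub>free_alg A\<^esub> H)"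
proof -
  interpret ring A by fact
  note expand = free_alg_mult_sum_left free_alg_mult_sum_right
  let ?s = "\<lambda>F a. Poly_Mapping.single a (Poly_Mapping.lookup F a)"
  have carr: "a \<in> carrier A" if "a \<in> Poly_Mapping.keys F \<union> Poly_Mapping.keys G \<union> Poly_Mapping.keys H" for a
    using that F G H by (auto simp: free_alg_def)
  \<comment> \<open>Associativity is trilinear, so it is reduced to basis vectors by expanding one
    factor at a time: here \<open>H\<close>, then \<open>G\<close>, and finally
    \<open>F\<close>.\<close>
  have 1: "(?s F a \<otimes>\<^bsub>free_alg A\<^esub> ?s G b) \<otimes>\<^bsub>free_alg A\<^esub> H =
      ?s F a \<otimes>\<^bsub>free_alg A\<^esub> (?s G b \<otimes>\<^bsub>free_alg A\<^esub> H)"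
    if "a \<in> Poly_Mapping.keys F" "b \<in> Poly_Mapping.keys G" for a b
  proof -
    have "(?s F a \<otimes>\<^bsub>free_alg A\<^esub> ?s G b) \<otimes>\<^bsub>free_alg A\<^esub> (\<Sum>c\<in>Poly_Mapping.keys H. ?s H c) =
      ?s F a \<otimes>\<^bsub>free_alg A\<^esub> (?s G b \<otimes>\<^bsub>free_alg A\<^esub> (\<Sum>c\<in>Poly_Mapping.keys H. ?s H c))"
      unfolding expand free_alg_mult_single
      by (rule sum.cong) (use that in \<open>simp_all add: carr m_assoc mult.assoc\<close>)
    then show ?thesis unfolding mpoly_decompose .
  qed
  have 2: "(?s F a \<otimes>\<^bsub>free_alg A\<^esub> G) \<otimes>\<^bsub>free_alg A\<^esub> H =
      ?s F a \<otimes>\<^bsub>free_alg A\<^esub> (G \<otimes>\<^bsub>free_alg A\<^esub> H)"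
    if "a \<in> Poly_Mapping.keys F" for a
  proof -
    have "(?s F a \<otimes>\<^bsub>free_alg A\<^esub> (\<Sum>b\<in>Poly_Mapping.keys G. ?s G b)) \<otimes>\<^bsub>free_alg A\<^esub> H =
      ?s F a \<otimes>\<^bsub>free_alg A\<^esub> ((\<Sum>b\<in>Poly_Mapping.keys G. ?s G b) \<otimes>\<^bsub>free_alg A\<^esub> H)"
      unfolding expand by (rule sum.cong[OF refl]) (rule 1[OF that])
    then show ?thesis unfolding mpoly_decompose .
  qed
  have "((\<Sum>a\<in>Poly_Mapping.keys F. ?s F a) \<otimes>\<^bsub>free_alg A\<^esub> G) \<otimes>\<^bsub>free_alg A\<^esub> H =
      (\<Sum>a\<in>Poly_Mapping.keys F. ?s F a) \<otimes>\<^bsub>free_alg A\<^esub> (G \<otimes>\<^bsub>free_alg A\<^esub> H)"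
    unfolding expand by (rule sum.cong[OF refl]) (rule 2)
  then show ?thesis unfolding mpoly_decompose .
qed

lemma keys_sum_subset: "Poly_Mapping.keys (sum F K) \<subseteq> (\<Union>i\<in>K. Poly_Mapping.keys (F i))"
proof (induction K rule: infinite_finite_induct)
  case (insert i K)
  then show ?case using Poly_Mapping.keys_add[of "F i" "sum F K"] by auto
qed auto

lemma ring_free_alg:
  fixes A :: "('a, 'r, 'm) module_scheme" (structure)
  assumes A: "ring A"
  shows "ring (free_alg A :: ('l::field, 'r \<Rightarrow>\<^sub>0 'l) module)"
proof (intro ringI abelian_groupI monoidI)
  let ?R = "free_alg A :: ('l, 'r \<Rightarrow>\<^sub>0 'l) module"
  interpret ring A by fact
  fix F G H assume F: "F \<in> carrier ?R" and G: "G \<in> carrier ?R" and H: "H \<in> carrier ?R"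
  show "F \<oplus>\<^bsub>?R\<^esub> G \<in> carrier ?R"
    using F G Poly_Mapping.keys_add[of F G] by (auto simp: free_alg_def)
  show "\<exists>G\<in>carrier ?R. G \<oplus>\<^bsub>?R\<^esub> F = \<zero>\<^bsub>?R\<^esub>"
    using F by (intro bexI[of _ "- F"]) (auto simp: free_alg_def in_keys_iff)
  have "a \<in> carrier A" if "a \<in> Poly_Mapping.keys (F \<otimes>\<^bsub>?R\<^esub> G)" for a
  proof -
    have "a \<in> Poly_Mapping.keys (\<Sum>a\<in>Poly_Mapping.keys F. \<Sum>b\<in>Poly_Mapping.keys G.
        Poly_Mapping.single (a \<otimes> b) (Poly_Mapping.lookup F a * Poly_Mapping.lookup G b))"
      using that by (simp add: free_alg_def)
    then obtain b where "b \<in> Poly_Mapping.keys F" "a \<in> Poly_Mapping.keys (\<Sum>c\<in>Poly_Mapping.keys G.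
        Poly_Mapping.single (b \<otimes> c) (Poly_Mapping.lookup F b * Poly_Mapping.lookup G c))"
      by (rule UN_E[OF subsetD[OF keys_sum_subset]])
    moreover from this(2) obtain c where "c \<in> Poly_Mapping.keys G"
        "a \<in> Poly_Mapping.keys (Poly_Mapping.single (b \<otimes> c) (Poly_Mapping.lookup F b * Poly_Mapping.lookup G c))"
      by (rule UN_E[OF subsetD[OF keys_sum_subset]])
    moreover from this(2) have "a = b \<otimes> c" by (simp split: if_splits)
    ultimately show ?thesis using F G by (auto simp: free_alg_def)
  qed
  then show "F \<otimes>\<^bsub>?R\<^esub> G \<in> carrier ?R" by (auto simp: free_alg_def)
  show "(F \<otimes>\<^bsub>?R\<^esub> G) \<otimes>\<^bsub>?R\<^esub> H = F \<otimes>\<^bsub>?R\<^esub> (G \<otimes>\<^bsub>?R\<^esub> H)" using A F G H by (rule free_alg_mult_assoc)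
  have one: "\<one>\<^bsub>?R\<^esub> = Poly_Mapping.single \<one> 1" by (simp add: free_alg_def)
  let ?S = "\<Sum>a\<in>Poly_Mapping.keys F. Poly_Mapping.single a (Poly_Mapping.lookup F a)"
  have carr: "a \<in> carrier A" if "a \<in> Poly_Mapping.keys F" for a using F that by (auto simp: free_alg_def)
  have "\<one>\<^bsub>?R\<^esub> \<otimes>\<^bsub>?R\<^esub> ?S = ?S" "?S \<otimes>\<^bsub>?R\<^esub> \<one>\<^bsub>?R\<^esub> = ?S"
    unfolding one free_alg_mult_sum_left free_alg_mult_sum_right free_alg_mult_single
    by (simp_all add: carr)
  then show "\<one>\<^bsub>?R\<^esub> \<otimes>\<^bsub>?R\<^esub> F = F" "F \<otimes>\<^bsub>?R\<^esub> \<one>\<^bsub>?R\<^esub> = F"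
    unfolding mpoly_decompose .
  show "(F \<oplus>\<^bsub>?R\<^esub> G) \<otimes>\<^bsub>?R\<^esub> H = F \<otimes>\<^bsub>?R\<^esub> H \<oplus>\<^bsub>?R\<^esub> G \<otimes>\<^bsub>?R\<^esub> H"
    using free_alg_mult_add_left[of A F G H] by (simp add: free_alg_def)
  show "H \<otimes>\<^bsub>?R\<^esub> (F \<oplus>\<^bsub>?R\<^esub> G) = H \<otimes>\<^bsub>?R\<^esub> F \<oplus>\<^bsub>?R\<^esub> H \<otimes>\<^bsub>?R\<^esub> G"
    using free_alg_mult_add_right[of A H F G] by (simp add: free_alg_def)
qed (use ring.ring_simprules(6)[OF A] in \<open>simp_all add: free_alg_def ac_simps\<close>)

lemma unital_alg_free_alg:
  fixes A :: "('a, 'r, 'm) module_scheme" (structure)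
  assumes A: "ring A"
  shows "unital_alg (free_alg A :: ('l::field, 'r \<Rightarrow>\<^sub>0 'l) module)"
proof (intro unital_alg.intro unital_alg_axioms.intro ring_free_alg A)
  let ?R = "free_alg A :: ('l, 'r \<Rightarrow>\<^sub>0 'l) module"
  interpret ring A by fact
  fix c :: 'l
  have scalar: "c \<odot>\<^bsub>?R\<^esub> \<one>\<^bsub>?R\<^esub> = Poly_Mapping.single \<one> c" by (simp add: free_alg_def)
  then show "c \<odot>\<^bsub>?R\<^esub> \<one>\<^bsub>?R\<^esub> \<in> carrier ?R" by (simp add: free_alg_def)
  fix F assume F: "F \<in> carrier ?R"
  have carr: "a \<in> carrier A" if "a \<in> Poly_Mapping.keys F" for a using F that by (auto simp: free_alg_def)
  have "Poly_Mapping.single \<one> c \<otimes>\<^bsub>?R\<^esub> F =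
      (\<Sum>a\<in>Poly_Mapping.keys F. Poly_Mapping.single a (c * Poly_Mapping.lookup F a))"
    using free_alg_mult_sum_right[of A "Poly_Mapping.single \<one> c"
        "\<lambda>a. Poly_Mapping.single a (Poly_Mapping.lookup F a)" "Poly_Mapping.keys F"]
    by (simp add: mpoly_decompose free_alg_mult_single carr)
  also have "\<dots> = c \<odot>\<^bsub>?R\<^esub> F"
    by (rule poly_mapping_eqI) (simp add: free_alg_def lookup_sum lookup_single when_def
        sum.delta in_keys_iff Poly_Mapping.map.rep_eq)
  finally show "c \<odot>\<^bsub>?R\<^esub> F = (c \<odot>\<^bsub>?R\<^esub> \<one>\<^bsub>?R\<^esub>) \<otimes>\<^bsub>?R\<^esub> F" unfolding scalar by simp
qed

text \<open>The k-algebra homomorphisms into \<open>k^alg\<close>. They are not an instance of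
  \<open>alg_hom\<close>, because \<open>field_alg\<close> over \<open>k^alg\<close> has scalars in
  \<open>k^alg\<close>, whereas those of \<open>A\<close> lie in k and act through
  \<open>to_ac\<close>.\<close>

definition ac_points :: "('a::field, 'r, 'm) module_scheme \<Rightarrow> ('r \<Rightarrow> 'a alg_closure) set" where
  "ac_points A = {\<psi> \<in> ring_hom A (field_alg :: ('a alg_closure, 'a alg_closure) module).
     \<forall>c. \<forall>a\<in>carrier A. \<psi> (c \<odot>\<^bsub>A\<^esub> a) = to_ac c * \<psi> a}"

lemma ac_points_iff:
  "\<psi> \<in> ac_points A \<longleftrightarrow>
    (\<forall>a\<in>carrier A. \<forall>b\<in>carrier A. \<psi> (a \<oplus>\<^bsub>A\<^esub> b) = \<psi> a + \<psi> b \<and> \<psi> (a \<otimes>\<^bsub>A\<^esub> b) = \<psi> a * \<psi> b) \<and>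
    \<psi> \<one>\<^bsub>A\<^esub> = 1 \<and> (\<forall>c. \<forall>a\<in>carrier A. \<psi> (c \<odot>\<^bsub>A\<^esub> a) = to_ac c * \<psi> a)"
  by (auto simp: ac_points_def ring_hom_def field_alg_def)

text \<open>The \<open>k^alg\<close>-linear map on the free module determined by its values on the
  basis vectors; it is the candidate for the point of the base change lying over
  \<open>\<psi>\<close>.\<close>

definition linear_extension :: "('r \<Rightarrow> 'l::field) \<Rightarrow> ('r \<Rightarrow>\<^sub>0 'l) \<Rightarrow> 'l" where
  "linear_extension \<psi> F = (\<Sum>a\<in>Poly_Mapping.keys F. Poly_Mapping.lookup F a * \<psi> a)"

lemma linear_extension_superset:
  "finite M \<Longrightarrow> Poly_Mapping.keys F \<subseteq> M \<Longrightarrow>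
    linear_extension \<psi> F = (\<Sum>a\<in>M. Poly_Mapping.lookup F a * \<psi> a)"
  unfolding linear_extension_def by (rule sum.mono_neutral_left) (auto simp: in_keys_iff)

lemma linear_extension_add:
  "linear_extension \<psi> (F + G) = linear_extension \<psi> F + linear_extension \<psi> G"
proof -
  let ?X = "Poly_Mapping.keys F \<union> Poly_Mapping.keys G"
  have X: "finite ?X" "Poly_Mapping.keys (F + G) \<subseteq> ?X" using Poly_Mapping.keys_add[of F G] by auto
  show ?thesis
    using X by (simp add: linear_extension_superset[of ?X] lookup_add distrib_right sum.distrib)
qed

lemma linear_extension_zero [simp]: "linear_extension \<psi> 0 = 0"
  by (simp add: linear_extension_def)

lemma linear_extension_sum:
  "linear_extension \<psi> (sum F K) = (\<Sum>i\<in>K. linear_extension \<psi> (F i))"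
  by (induction K rule: infinite_finite_induct) (simp_all add: linear_extension_add)

lemma linear_extension_diff:
  "linear_extension \<psi> (F - G) = linear_extension \<psi> F - linear_extension \<psi> G"
  using linear_extension_add[of \<psi> "F - G" G] by simp

lemma linear_extension_single [simp]:
  "linear_extension \<psi> (Poly_Mapping.single a c) = c * \<psi> a"
  by (simp add: linear_extension_superset[of "{a}"])

lemma linear_extension_alg_hom:
  fixes A :: "('a::field, 'r, 'm) module_scheme"
  assumes A: "ring A" and \<psi>: "\<psi> \<in> ac_points A"
  shows "linear_extension \<psi> \<in> alg_hom (free_alg A) field_alg"
proof -
  let ?L = "free_alg A :: ('a alg_closure, 'r \<Rightarrow>\<^sub>0 'a alg_closure) module"
  interpret L: unital_alg ?L using A by (rule unital_alg_free_alg)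
  have mult: "linear_extension \<psi> (F \<otimes>\<^bsub>?L\<^esub> G) = linear_extension \<psi> F * linear_extension \<psi> G"
    if "F \<in> carrier ?L" "G \<in> carrier ?L" for F G
  proof -
    have carr: "a \<in> carrier A" if "a \<in> Poly_Mapping.keys F \<or> a \<in> Poly_Mapping.keys G" for a
      using that \<open>F \<in> _\<close> \<open>G \<in> _\<close> by (auto simp: free_alg_def)
    have "linear_extension \<psi> (F \<otimes>\<^bsub>?L\<^esub> G) = (\<Sum>a\<in>Poly_Mapping.keys F. \<Sum>b\<in>Poly_Mapping.keys G.
        Poly_Mapping.lookup F a * Poly_Mapping.lookup G b * \<psi> (a \<otimes>\<^bsub>A\<^esub> b))"
      by (simp add: free_alg_def linear_extension_sum)
    also have "\<dots> = (\<Sum>a\<in>Poly_Mapping.keys F. \<Sum>b\<in>Poly_Mapping.keys G.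
        Poly_Mapping.lookup F a * \<psi> a * (Poly_Mapping.lookup G b * \<psi> b))"
      using \<psi> by (intro sum.cong refl) (simp add: carr ac_points_iff)
    finally show ?thesis by (simp add: linear_extension_def sum_product)
  qed
  have one: "\<one>\<^bsub>?L\<^esub> = Poly_Mapping.single \<one>\<^bsub>A\<^esub> 1" by (simp add: free_alg_def)
  have scalar: "c \<odot>\<^bsub>?L\<^esub> \<one>\<^bsub>?L\<^esub> = Poly_Mapping.single \<one>\<^bsub>A\<^esub> c" for c by (simp add: free_alg_def)
  have "linear_extension \<psi> (c \<odot>\<^bsub>?L\<^esub> F) = c * linear_extension \<psi> F" if "F \<in> carrier ?L" for c F
  proof -
    have "linear_extension \<psi> ((c \<odot>\<^bsub>?L\<^esub> \<one>\<^bsub>?L\<^esub>) \<otimes>\<^bsub>?L\<^esub> F) = c * linear_extension \<psi> F"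
      using mult[OF L.scalar_closed that] \<psi> by (simp add: scalar ac_points_iff)
    then show ?thesis using L.smult_eq[OF that] by simp
  qed
  moreover have "linear_extension \<psi> (F \<oplus>\<^bsub>?L\<^esub> G) = linear_extension \<psi> F + linear_extension \<psi> G" for F G
    by (simp add: free_alg_def linear_extension_add)
  moreover have "linear_extension \<psi> \<one>\<^bsub>?L\<^esub> = 1" using \<psi> by (simp add: one ac_points_iff)
  ultimately show ?thesis
    using mult by (auto simp: alg_hom_def ring_hom_def field_alg_def)
qed

text \<open>This is the universal property of the tensor product: points of the base change restrict
  along \<open>tensor_one A\<close> to elements of \<open>ac_points A\<close>, and each such element
  extends. Both directions preserve the value at \<open>g\<close>.\<close>

lemma factors_through_Gm_iff:
  fixes A :: "('a::field, 'r, 'm) module_scheme"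
  assumes A: "unital_alg A" and g: "g \<in> carrier A"
  shows "factors_through_Gm A g \<longleftrightarrow> (\<forall>\<psi>\<in>ac_points A. \<psi> g \<noteq> 0)"
proof -
  let ?L = "free_alg A :: ('a alg_closure, 'r \<Rightarrow>\<^sub>0 'a alg_closure) module"
  let ?T = "tensor_ideal A"
  interpret A: unital_alg A by fact
  interpret L: unital_alg ?L by (rule unital_alg_free_alg[OF A.ring_axioms])
  have single: "Poly_Mapping.single a c \<in> carrier ?L" if "a \<in> carrier A" for a c
    using that by (auto simp: free_alg_def)
  have diff: "F - G \<in> carrier ?L" if "F \<in> carrier ?L" "G \<in> carrier ?L" for F G
    using that Poly_Mapping.keys_diff[of F G] by (auto simp: free_alg_def)
  have rel: "linearity_relations A \<subseteq> carrier ?L"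
    unfolding linearity_relations_def by (auto intro!: diff single)
  have T: "ideal ?T ?L" unfolding tensor_ideal_def by (rule L.genideal_ideal[OF rel])
  have relT: "linearity_relations A \<subseteq> ?T" unfolding tensor_ideal_def by (rule L.genideal_self[OF rel])
  interpret T: ideal ?T ?L by (rule T)
  note proj = L.quot_alg_proj[OF T, folded base_change_def]
  have to_point: "(\<lambda>a. \<phi> (tensor_one A a)) \<in> ac_points A"
    if \<phi>: "\<phi> \<in> rational_points (base_change A)" for \<phi>
  proof -
    define \<chi> where "\<chi> F = \<phi> (?T +>\<^bsub>?L\<^esub> F)" for F
    have \<chi>: "\<chi> \<in> alg_hom ?L field_alg"
      using alg_hom_comp[OF proj \<phi>[unfolded rational_points_def]] by (simp add: \<chi>_def[abs_def] o_def)
    have add: "\<chi> (F + G) = \<chi> F + \<chi> G" and mult: "\<chi> (F \<otimes>\<^bsub>?L\<^esub> G) = \<chi> F * \<chi> G"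
      and smult: "\<chi> (Poly_Mapping.map ((*) c) F) = c * \<chi> F"
      if "F \<in> carrier ?L" "G \<in> carrier ?L" for F G c
      using alg_homD(3,4)[OF \<chi> that] alg_homD(5)[OF \<chi> that(1), of c]
      by (simp_all add: field_alg_def) (simp_all add: free_alg_def)
    have one: "\<chi> (Poly_Mapping.single \<one>\<^bsub>A\<^esub> 1) = 1"
      using alg_homD(2)[OF \<chi>] by (simp add: field_alg_def free_alg_def)
    \<comment> \<open>Elements differing by a linearity relation have the same coset modulo
      \<open>?T\<close>; this turns the relations into additivity and k-linearity of the restricted
      map.\<close>
    have eq: "\<chi> F = \<chi> G"
      if "F \<in> carrier ?L" "G \<in> carrier ?L" "F - G \<in> linearity_relations A" for F G
    proof -
      have "F \<in> ?T +>\<^bsub>?L\<^esub> G"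
        using that relT by (auto simp: a_r_coset_def' free_alg_def intro!: bexI[of _ "F - G"])
      then show ?thesis using T.a_repr_independence'[of F G] that by (simp add: \<chi>_def)
    qed
    have "\<chi> (Poly_Mapping.single (a \<oplus>\<^bsub>A\<^esub> b) 1) =
        \<chi> (Poly_Mapping.single a 1) + \<chi> (Poly_Mapping.single b 1)"
      if "a \<in> carrier A" "b \<in> carrier A" for a b
    proof -
      have "\<chi> (Poly_Mapping.single (a \<oplus>\<^bsub>A\<^esub> b) 1) =
          \<chi> (Poly_Mapping.single a 1 + Poly_Mapping.single b 1)"
      proof (rule eq)
        show "Poly_Mapping.single a 1 + Poly_Mapping.single b 1 \<in> carrier ?L"
          using that single L.a_closed by (simp add: free_alg_def)
        show "Poly_Mapping.single (a \<oplus>\<^bsub>A\<^esub> b) 1 - (Poly_Mapping.single a 1 + Poly_Mapping.single b 1)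
            \<in> linearity_relations A"
          unfolding linearity_relations_def diff_diff_add[symmetric] using that by blast
      qed (use that single in simp)
      then show ?thesis using that by (simp add: add single)
    qed
    moreover have "\<chi> (Poly_Mapping.single (a \<otimes>\<^bsub>A\<^esub> b) 1) =
        \<chi> (Poly_Mapping.single a 1) * \<chi> (Poly_Mapping.single b 1)"
      if "a \<in> carrier A" "b \<in> carrier A" for a b
      using mult[of "Poly_Mapping.single a 1" "Poly_Mapping.single b 1"] that
      by (simp add: single free_alg_mult_single)
    moreover have "\<chi> (Poly_Mapping.single (c \<odot>\<^bsub>A\<^esub> a) 1) = to_ac c * \<chi> (Poly_Mapping.single a 1)"
      if "a \<in> carrier A" for a c
    proof -
      have "\<chi> (Poly_Mapping.single (c \<odot>\<^bsub>A\<^esub> a) 1) = \<chi> (Poly_Mapping.single a (to_ac c))"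
      proof (rule eq[OF single single])
        show "Poly_Mapping.single (c \<odot>\<^bsub>A\<^esub> a) 1 - Poly_Mapping.single a (to_ac c) \<in> linearity_relations A"
          unfolding linearity_relations_def using that by blast
      qed (use that in auto)
      also have "\<dots> = to_ac c * \<chi> (Poly_Mapping.single a 1)"
        using smult[of "Poly_Mapping.single a 1" "Poly_Mapping.single a 1" "to_ac c"] that
        by (simp add: single)
      finally show ?thesis .
    qed
    ultimately show ?thesis using one unfolding ac_points_iff tensor_one_def \<chi>_def by blast
  qed
  have from_point: "\<exists>\<phi>\<in>rational_points (base_change A). \<phi> (tensor_one A g) = \<psi> g"
    if \<psi>: "\<psi> \<in> ac_points A" for \<psi>
  proof -
    note hom = linear_extension_alg_hom[OF A.ring_axioms \<psi>]
    interpret F: ring "field_alg :: ('a alg_closure, 'a alg_closure) module" by (rule ring_field_alg)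
    interpret \<Psi>: ring_hom_ring ?L "field_alg :: ('a alg_closure, 'a alg_closure) module" "linear_extension \<psi>"
      using hom by (intro ring_hom_ringI2 L.ring_axioms F.ring_axioms) (simp add: alg_hom_def)
    \<comment> \<open>It suffices to kill the generators of the tensor ideal, because the kernel of
      a ring homomorphism is an ideal.\<close>
    have "linearity_relations A \<subseteq> a_kernel ?L field_alg (linear_extension \<psi>)"
    proof
      fix F assume F: "F \<in> linearity_relations A"
      then have "linear_extension \<psi> F = 0"
        using \<psi> by (auto simp: linearity_relations_def linear_extension_diff ac_points_iff)
      then show "F \<in> a_kernel ?L field_alg (linear_extension \<psi>)"
        unfolding a_kernel_def' using subsetD[OF rel F] by (simp add: field_alg_def)
    qed
    then have kernel: "?T \<subseteq> a_kernel ?L field_alg (linear_extension \<psi>)"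
      unfolding tensor_ideal_def by (rule L.genideal_minimal[OF \<Psi>.kernel_is_ideal])
    have vanish: "linear_extension \<psi> F = \<zero>\<^bsub>field_alg\<^esub>" if "F \<in> ?T" for F
      using subsetD[OF kernel that] unfolding a_kernel_def' by blast
    obtain \<phi> where \<phi>: "\<phi> \<in> alg_hom (base_change A) field_alg"
        "\<And>F. F \<in> carrier ?L \<Longrightarrow> \<phi> (?T +>\<^bsub>?L\<^esub> F) = linear_extension \<psi> F"
      unfolding base_change_def by (rule L.quot_alg_lift[OF T ring_field_alg hom]) (use vanish that in blast)+
    then have "\<phi> (tensor_one A g) = \<psi> g" using g single by (simp add: tensor_one_def)
    then show ?thesis using \<phi>(1) by (auto simp: rational_points_def)
  qed
  show ?thesis
  proof
    assume "factors_through_Gm A g"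
    then have "\<phi> (tensor_one A g) \<noteq> 0" if "\<phi> \<in> rational_points (base_change A)" for \<phi>
      using that by (auto simp: factors_through_Gm_def base_change_fun_def Gm_def)
    then show "\<forall>\<psi>\<in>ac_points A. \<psi> g \<noteq> 0" using from_point by metis
  next
    assume "\<forall>\<psi>\<in>ac_points A. \<psi> g \<noteq> 0"
    then have "\<phi> (tensor_one A g) \<noteq> 0" if "\<phi> \<in> rational_points (base_change A)" for \<phi>
      by (rule bspec[OF _ to_point[OF that]])
    then show "factors_through_Gm A g"
      by (auto simp: factors_through_Gm_def base_change_fun_def Gm_def)
  qed
qed


section \<open>Algebras presented by an algebraic set\<close>

lemma (in ring) ideal_from_closure:
  assumes "I \<subseteq> carrier R" "\<zero> \<in> I" "\<And>a b. a \<in> I \<Longrightarrow> b \<in> I \<Longrightarrow> a \<oplus> b \<in> I"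
    "\<And>a r. a \<in> I \<Longrightarrow> r \<in> carrier R \<Longrightarrow> r \<otimes> a \<in> I" "\<And>a r. a \<in> I \<Longrightarrow> r \<in> carrier R \<Longrightarrow> a \<otimes> r \<in> I"
  shows "ideal I R"
proof (rule idealI[OF ring_axioms])
  show "subgroup I (add_monoid R)"
  proof
    fix a assume a: "a \<in> I"
    then have "\<ominus> \<one> \<otimes> a \<in> I" by (rule assms) simp
    then show "inv\<^bsub>add_monoid R\<^esub> a \<in> I"
      using a assms(1) by (simp add: l_minus subset_iff flip: a_inv_def)
  qed (use assms in auto)
qed (use assms in auto)

lemma ring_poly_alg: "ring (poly_alg n :: ('a::field, 'a mpoly) module)"
proof (intro ringI abelian_groupI monoidI)
  fix f :: "'a mpoly" assume "f \<in> carrier (poly_alg n)"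
  then show "\<exists>g\<in>carrier (poly_alg n). g \<oplus>\<^bsub>poly_alg n\<^esub> f = \<zero>\<^bsub>poly_alg n\<^esub>"
    by (intro bexI[of _ "- f"]) (simp_all add: poly_alg_def polys_uminus)
qed (simp_all add: poly_alg_def polys_add polys_mult algebra_simps)

lemma unital_alg_poly_alg: "unital_alg (poly_alg n :: ('a::field, 'a mpoly) module)"
  by (intro unital_alg.intro unital_alg_axioms.intro ring_poly_alg) (simp_all add: poly_alg_def)

lemma ideal_vanishing: "ideal (vanishing_ideal n S) (poly_alg n)"
  by (rule ring.ideal_from_closure[OF ring_poly_alg])
    (auto simp: poly_alg_def vanishing_ideal_def polys_add polys_mult mpoly_eval_add mpoly_eval_mult)

text \<open>The polynomials satisfying \<open>P\<close> form a subring that contains the constants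
  and the variables; adjoining the variables one after another fills \<open>polys n\<close>.\<close>

lemma polys_induct [consumes 1, case_names const var add mult]:
  fixes f :: "'a::comm_ring_1 mpoly"
  assumes f: "f \<in> polys n"
    and const: "\<And>c. P (mconst c)" and var: "\<And>i. i < n \<Longrightarrow> P (mvar i)"
    and add: "\<And>f g. f \<in> polys n \<Longrightarrow> g \<in> polys n \<Longrightarrow> P f \<Longrightarrow> P g \<Longrightarrow> P (f + g)"
    and mult: "\<And>f g. f \<in> polys n \<Longrightarrow> g \<in> polys n \<Longrightarrow> P f \<Longrightarrow> P g \<Longrightarrow> P (f * g)"
  shows "P f"
proof -
  let ?E = "{f \<in> polys n. P f}"
  have uminus: "P (- f)" if "f \<in> polys n" "P f" for f
    using mult[OF mconst_in_polys that(1) const that(2), of "- 1"] by (simp add: single_uminus)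
  have E: "subring_of ?E"
    unfolding subring_of_def
    using const[of 0] const[of 1] add mult uminus by (auto simp: polys_add polys_mult polys_uminus)
  \<comment> \<open>The bound \<open>m \<le> n\<close> keeps every adjoined variable within the
    range of the hypothesis \<open>var\<close>, while \<open>n\<close> itself stays fixed.\<close>
  have "polys m \<subseteq> ?E" if "m \<le> n" for m
    using that
  proof (induction m)
    case 0
    show ?case
    proof
      fix f :: "'a mpoly" assume "f \<in> polys 0"
      then obtain c where "f = mconst c" using polys_0 by blast
      then show "f \<in> ?E" by (simp add: const)
    qed
  next
    case (Suc m)
    show ?case
      unfolding polys_Suc
    proof
      fix f :: "'a mpoly" assume "f \<in> adjoin (polys m) (mvar m)"
      then obtain d where "f \<in> bounded_combinations (polys m) (mvar m) d" by (auto simp: adjoin_def)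
      then obtain r where r: "\<forall>i. r i \<in> polys m" "f = (\<Sum>i<d. r i * mvar m ^ i)"
        by (rule bounded_combinationsE)
      have "r i \<in> ?E" for i using r(1) Suc by auto
      moreover have "mvar m \<in> ?E" using Suc.prems var by (simp add: mvar_in_polys)
      ultimately show "f \<in> ?E"
        unfolding r(2) by (intro subring_of_sum[OF E] subring_ofD(4)[OF E] subring_of_power[OF E])
    qed
  qed
  then show ?thesis using f by blast
qed

lemma eval_to_ac_diff: "eval_along to_ac (f - g) x = eval_along to_ac f x - eval_along to_ac g x"
  using eval_to_ac_add[of "f - g" g x] by simp

lemma mpoly_eval_prod:
  fixes F :: "'b \<Rightarrow> 'a::comm_ring_1 mpoly"
  shows "mpoly_eval (\<Prod>i\<in>A. F i) x = (\<Prod>i\<in>A. mpoly_eval (F i) x)"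
  by (induction A rule: infinite_finite_induct) (simp_all add: mpoly_eval_mult)

lemma polys_diff:
  fixes f g :: "'a::comm_ring_1 mpoly"
  shows "f \<in> polys n \<Longrightarrow> g \<in> polys n \<Longrightarrow> f - g \<in> polys n"
  by (rule subring_ofD(6)[OF subring_of_polys])

lemma polys_prod:
  fixes F :: "'b \<Rightarrow> 'a::comm_ring_1 mpoly"
  shows "(\<And>i. i \<in> A \<Longrightarrow> F i \<in> polys n) \<Longrightarrow> (\<Prod>i\<in>A. F i) \<in> polys n"
  by (induction A rule: infinite_finite_induct) (simp_all add: polys_mult)

section \<open>Translation between polynomials on \<open>S\<close> and elements of V\<close>

locale presentation = unital_alg V for V :: "('a::field, 'r, 'm) module_scheme" (structure) +
  fixes n :: nat and S :: "(nat \<Rightarrow> 'a) set" and \<pi> :: "'a mpoly \<Rightarrow> 'r"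
  assumes comm: "cring V"
    and S: "algebraic_set n S"
    and hom: "\<pi> \<in> alg_hom (poly_alg n) V"
    and surj: "\<pi> ` polys n = carrier V"
    and kernel: "f \<in> polys n \<Longrightarrow> \<pi> f = \<zero> \<longleftrightarrow> f \<in> vanishing_ideal n S"
begin

lemma pi_closed [simp]: "f \<in> polys n \<Longrightarrow> \<pi> f \<in> carrier V"
  using surj by blast

lemma pi_add: "f \<in> polys n \<Longrightarrow> g \<in> polys n \<Longrightarrow> \<pi> (f + g) = \<pi> f \<oplus> \<pi> g"
  using alg_homD(3)[OF hom, of f g] by (simp add: poly_alg_def)

lemma pi_mult: "f \<in> polys n \<Longrightarrow> g \<in> polys n \<Longrightarrow> \<pi> (f * g) = \<pi> f \<otimes> \<pi> g"
  using alg_homD(4)[OF hom, of f g] by (simp add: poly_alg_def)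

lemma pi_one: "\<pi> 1 = \<one>"
  using alg_homD(2)[OF hom] by (simp add: poly_alg_def)

lemma pi_smult: "f \<in> polys n \<Longrightarrow> \<pi> (mconst c * f) = c \<odot> \<pi> f"
  using alg_homD(5)[OF hom, of f c] by (simp add: poly_alg_def)

lemma pi_const: "\<pi> (mconst c) = c \<odot> \<one>"
  using pi_smult[of 1 c] by (simp add: pi_one)

lemma pi_diff:
  assumes "f \<in> polys n" "g \<in> polys n" shows "\<pi> (f - g) = \<pi> f \<ominus> \<pi> g"
proof -
  have "\<pi> f = \<pi> (f - g) \<oplus> \<pi> g" using pi_add[of "f - g" g] assms by (simp add: polys_diff)
  then show ?thesis using assms by (simp add: minus_eq a_assoc r_neg polys_diff)
qed

lemma pi_zero_iff: "f \<in> polys n \<Longrightarrow> \<pi> f = \<zero> \<longleftrightarrow> (\<forall>x\<in>S. mpoly_eval f x = 0)"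
  by (simp add: kernel vanishing_ideal_def)

lemma pi_eq_iff:
  assumes "f \<in> polys n" "g \<in> polys n"
  shows "\<pi> f = \<pi> g \<longleftrightarrow> f - g \<in> vanishing_ideal n S"
  using assms kernel[of "f - g"] by (simp add: polys_diff pi_diff)

lemma carrierE:
  assumes "a \<in> carrier V" obtains f where "f \<in> polys n" "a = \<pi> f"
  using assms surj by blast

text \<open>Preimages of the same element of V differ by an element of I(S), which vanishes at
  \<open>p\<close>, so evaluation at \<open>p\<close> descends to V.\<close>

lemma ac_point_at_closure:
  assumes p: "p \<in> ac_closure n S"
  obtains \<psi> where "\<psi> \<in> ac_points V" "\<And>f. f \<in> polys n \<Longrightarrow> \<psi> (\<pi> f) = eval_along to_ac f p"
proof -
  define \<psi> where "\<psi> a = eval_along to_ac (SOME f. f \<in> polys n \<and> \<pi> f = a) p" for a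
  have \<psi>: "\<psi> (\<pi> f) = eval_along to_ac f p" if f: "f \<in> polys n" for f
  proof -
    define q where "q = (SOME q. q \<in> polys n \<and> \<pi> q = \<pi> f)"
    have q: "q \<in> polys n \<and> \<pi> q = \<pi> f" unfolding q_def by (rule someI[of _ f]) (simp add: f)
    then have "q - f \<in> vanishing_ideal n S" using pi_eq_iff[of q f] f by blast
    then have "eval_along to_ac (q - f) p = 0" using p ac_closure_iff by blast
    then show ?thesis by (simp add: \<psi>_def eval_to_ac_diff flip: q_def)
  qed
  have "\<psi> \<in> ac_points V"
    unfolding ac_points_iff
  proof (intro conjI ballI allI)
    show "\<psi> \<one> = 1" using \<psi>[of 1] by (simp add: pi_one)
  next
    fix a b c assume "a \<in> carrier V"
    then obtain f where f: "f \<in> polys n" "a = \<pi> f" by (rule carrierE)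
    then show "\<psi> (c \<odot> a) = to_ac c * \<psi> a"
      using \<psi>[of "mconst c * f"] \<psi>[of f] by (simp add: pi_smult polys_mult eval_to_ac_mult)
    assume "b \<in> carrier V"
    then obtain g where g: "g \<in> polys n" "b = \<pi> g" by (rule carrierE)
    show "\<psi> (a \<oplus> b) = \<psi> a + \<psi> b"
      using f g \<psi>[of "f + g"] \<psi>[of f] \<psi>[of g] by (simp add: pi_add polys_add eval_to_ac_add)
    show "\<psi> (a \<otimes> b) = \<psi> a * \<psi> b"
      using f g \<psi>[of "f * g"] \<psi>[of f] \<psi>[of g] by (simp add: pi_mult polys_mult eval_to_ac_mult)
  qed
  then show thesis using \<psi> that by blast
qed

lemma closure_point_of_ac_point:
  assumes \<psi>: "\<psi> \<in> ac_points V"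
  obtains p where "p \<in> ac_closure n S" "\<And>f. f \<in> polys n \<Longrightarrow> \<psi> (\<pi> f) = eval_along to_ac f p"
proof -
  \<comment> \<open>The coordinates are the images of the variables; a homomorphism is determined by
    these, so \<open>\<psi>\<close> becomes evaluation at \<open>p\<close>.\<close>
  define p where "p = (\<lambda>i\<in>{..<n}. \<psi> (\<pi> (mvar i)))"
  have \<psi>D: "\<psi> (a \<oplus> b) = \<psi> a + \<psi> b" "\<psi> (a \<otimes> b) = \<psi> a * \<psi> b" "\<psi> \<one> = 1" "\<psi> (c \<odot> a) = to_ac c * \<psi> a"
    if "a \<in> carrier V" "b \<in> carrier V" for a b c
    using \<psi> that unfolding ac_points_iff by blast+
  have eval: "\<psi> (\<pi> f) = eval_along to_ac f p" if "f \<in> polys n" for f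
    using that
  proof (induction rule: polys_induct)
    case (const c)
    show ?case using \<psi>D(3,4)[OF one_closed one_closed] by (simp add: pi_const)
  next
    case (var i)
    then show ?case by (simp add: p_def)
  next
    case (add f g)
    then show ?case by (simp add: pi_add \<psi>D eval_to_ac_add)
  next
    case (mult f g)
    then show ?case by (simp add: pi_mult \<psi>D eval_to_ac_mult)
  qed
  have "\<psi> \<zero> + \<psi> \<zero> = \<psi> \<zero> + 0" using \<psi>D(1)[OF zero_closed zero_closed] by (simp only: l_zero[OF zero_closed] add_0_right)
  then have "\<psi> \<zero> = 0" by (simp only: add_left_cancel)
  then have "eval_along to_ac f p = 0" if "f \<in> vanishing_ideal n S" for f
    using that eval[of f] kernel[of f] by (simp add: vanishing_ideal_def)
  moreover have "p \<in> affine_space n"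
    unfolding p_def affine_space_def by (rule restrict_PiE_iff[THEN iffD2]) simp
  ultimately show thesis using that[of p] eval by (simp add: ac_closure_iff)
qed

lemma zero_on_closure_iff:
  assumes f: "f \<in> polys n"
  shows "(\<exists>p\<in>ac_closure n S. eval_along to_ac f p = 0) \<longleftrightarrow> \<not> factors_through_Gm V (\<pi> f)"
proof -
  have "(\<exists>p\<in>ac_closure n S. eval_along to_ac f p = 0) \<longleftrightarrow> (\<exists>\<psi>\<in>ac_points V. \<psi> (\<pi> f) = 0)"
    using f ac_point_at_closure closure_point_of_ac_point by metis
  then show ?thesis using factors_through_Gm_iff[OF unital_alg_axioms pi_closed[OF f]] by blast
qed

section \<open>Points of \<open>S\<close> as prime ideals of V, and comparison of the notions of
  constancy\<close>

definition point_ideal :: "(nat \<Rightarrow> 'a) \<Rightarrow> 'r set" where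
  "point_ideal x = \<pi> ` {f \<in> polys n. mpoly_eval f x = 0}"

text \<open>For \<open>x\<close> in \<open>S\<close>, membership does not depend on the
  representative \<open>f\<close>, as elements of I(S) vanish at \<open>x\<close>.\<close>

lemma point_ideal_iff:
  assumes "x \<in> S" "f \<in> polys n"
  shows "\<pi> f \<in> point_ideal x \<longleftrightarrow> mpoly_eval f x = 0"
proof
  assume "\<pi> f \<in> point_ideal x"
  then obtain g where g: "g \<in> polys n" "mpoly_eval g x = 0" "\<pi> f = \<pi> g"
    by (auto simp: point_ideal_def)
  then have "mpoly_eval (f - g) x = 0"
    using assms pi_eq_iff[of f g] by (simp add: vanishing_ideal_def)
  then show "mpoly_eval f x = 0" using g by (simp add: mpoly_eval_diff)
qed (use assms in \<open>auto simp: point_ideal_def\<close>)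

text \<open>Evaluation at \<open>x\<close> takes values in a field, so a product vanishes only if a
  factor does, and the unit does not vanish.\<close>

lemma primeideal_point_ideal:
  assumes x: "x \<in> S" shows "primeideal (point_ideal x) V"
proof (rule primeidealI)
  have sub: "point_ideal x \<subseteq> carrier V" by (auto simp: point_ideal_def)
  show "ideal (point_ideal x) V"
  proof (rule ideal_from_closure[OF sub])
    have "\<pi> 0 = \<zero>" using pi_zero_iff[of 0] by simp
    moreover have "\<pi> 0 \<in> point_ideal x" using x by (simp add: point_ideal_iff)
    ultimately show "\<zero> \<in> point_ideal x" by simp
  next
    fix a b assume "a \<in> point_ideal x" "b \<in> point_ideal x"
    then obtain f g where "f \<in> polys n" "a = \<pi> f" "g \<in> polys n" "b = \<pi> g" "mpoly_eval f x = 0" "mpoly_eval g x = 0"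
      by (auto simp: point_ideal_def)
    then show "a \<oplus> b \<in> point_ideal x"
      using x by (simp add: point_ideal_iff mpoly_eval_add polys_add flip: pi_add)
  next
    fix a r assume "a \<in> point_ideal x" "r \<in> carrier V"
    then obtain f g where fg: "f \<in> polys n" "a = \<pi> f" "g \<in> polys n" "r = \<pi> g" "mpoly_eval f x = 0"
      by (auto simp: point_ideal_def elim: carrierE)
    then show "r \<otimes> a \<in> point_ideal x"
      using x by (simp add: point_ideal_iff mpoly_eval_mult polys_mult flip: pi_mult)
    show "a \<otimes> r \<in> point_ideal x"
      using fg x by (simp add: point_ideal_iff mpoly_eval_mult polys_mult flip: pi_mult)
  qed
  have "\<pi> 1 \<notin> point_ideal x" using x by (simp add: point_ideal_iff)
  moreover have "\<pi> 1 \<in> carrier V" by simp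
  ultimately show "carrier V \<noteq> point_ideal x" by blast
next
  fix a b assume ab: "a \<in> carrier V" "b \<in> carrier V" "a \<otimes> b \<in> point_ideal x"
  obtain f where f: "f \<in> polys n" "a = \<pi> f" using ab(1) by (rule carrierE)
  obtain g where g: "g \<in> polys n" "b = \<pi> g" using ab(2) by (rule carrierE)
  have "mpoly_eval (f * g) x = 0"
    using ab(3) f g x point_ideal_iff[of x "f * g"] by (simp add: pi_mult polys_mult)
  then show "a \<in> point_ideal x \<or> b \<in> point_ideal x"
    using f g x by (auto simp: point_ideal_iff mpoly_eval_mult)
qed (rule comm)

lemma const_on_points_iff:
  assumes "f \<in> polys n"
  shows "const_on_points V (\<pi> f) U \<longleftrightarrow> (\<exists>c. \<forall>P\<in>U. \<pi> (f - mconst c) \<in> P)"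
  unfolding const_on_points_def using assms by (simp add: pi_diff pi_const)

text \<open>Testing at the ideals of points recovers the values on \<open>S\<close>; conversely
  \<open>f - c\<close> vanishes on all of \<open>S\<close>, so its image is zero and lies in every
  prime ideal.\<close>

lemma regular_constant_iff:
  assumes f: "f \<in> polys n"
  shows "regular_constant V (\<pi> f) \<longleftrightarrow> mpoly_eval f constant_on S"
proof
  assume "regular_constant V (\<pi> f)"
  then obtain c where c: "\<And>P. P \<in> spectrum V \<Longrightarrow> \<pi> (f - mconst c) \<in> P"
    by (auto simp: regular_constant_def const_on_points_iff[OF f])
  have "mpoly_eval f x = c" if "x \<in> S" for x
  proof -
    have "\<pi> (f - mconst c) \<in> point_ideal x"
      using primeideal_point_ideal[OF that] by (intro c) (simp add: spectrum_def)
    then show ?thesis using that f by (simp add: point_ideal_iff polys_diff mpoly_eval_diff)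
  qed
  then show "mpoly_eval f constant_on S" by (auto simp: constant_on_def)
next
  assume "mpoly_eval f constant_on S"
  then obtain c where "\<And>x. x \<in> S \<Longrightarrow> mpoly_eval f x = c" by (auto simp: constant_on_def)
  then have "\<pi> (f - mconst c) = \<zero>"
    using f by (simp add: pi_zero_iff polys_diff mpoly_eval_diff)
  moreover have "\<zero> \<in> P" if "P \<in> spectrum V" for P
    using that by (auto simp: spectrum_def primeideal_def ideal_def additive_subgroup.zero_closed)
  ultimately show "regular_constant V (\<pi> f)"
    unfolding regular_constant_def const_on_points_iff[OF f] by metis
qed

lemma prime_prod_mem:
  assumes P: "primeideal P V" and A: "finite A" "\<And>i. i \<in> A \<Longrightarrow> F i \<in> polys n"
    and mem: "\<pi> (\<Prod>i\<in>A. F i) \<in> P"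
  shows "\<exists>i\<in>A. \<pi> (F i) \<in> P"
  using A mem
proof (induction A rule: finite_induct)
  case empty
  interpret P: primeideal P V by fact
  show ?case using empty P.one_imp_carrier P.I_notcarr by (simp add: pi_one)
next
  case (insert i A)
  interpret P: primeideal P V by fact
  have "\<pi> (F i) \<otimes> \<pi> (\<Prod>i\<in>A. F i) \<in> P"
    using insert by (simp add: polys_prod flip: pi_mult)
  then have "\<pi> (F i) \<in> P \<or> \<pi> (\<Prod>i\<in>A. F i) \<in> P"
    using insert by (intro P.I_prime) (simp_all add: polys_prod)
  then show ?case using insert by auto
qed

lemma regular_locally_constant_of_locally_constant:
  assumes f: "f \<in> polys n" and lc: "locally_constant (subtopology (zariski n) S) (mpoly_eval f)"
  shows "regular_locally_constant V (\<pi> f)"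
  unfolding regular_locally_constant_def
proof
  fix P assume "P \<in> spectrum V"
  then have P: "primeideal P V" by (simp add: spectrum_def)
  interpret P: primeideal P V by fact
  define C where "C = mpoly_eval f ` S"
  have C: "finite C" unfolding C_def by (rule locally_constant_finite_range[OF S lc])
  have polys: "f - mconst d \<in> polys n" for d using f by (simp add: polys_diff)
  \<comment> \<open>Up to a nonzero scalar, \<open>q c\<close> takes the value 1 where
    \<open>f\<close> equals \<open>c\<close> and 0 elsewhere on \<open>S\<close>; its nonvanishing
    locus in the spectrum will be the neighbourhood of \<open>P\<close>.\<close>
  define q where "q c = (\<Prod>d\<in>C - {c}. f - mconst d)" for c
  have q: "q c \<in> polys n" for c unfolding q_def by (intro polys_prod polys)
  have "mpoly_eval (\<Prod>d\<in>C. f - mconst d) x = 0" if "x \<in> S" for x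
    using that C by (auto simp: mpoly_eval_prod mpoly_eval_diff C_def intro!: prod_zero)
  then have zero: "\<pi> (\<Prod>d\<in>C. f - mconst d) = \<zero>" by (simp add: pi_zero_iff polys_prod polys)
  then have "\<exists>c\<in>C. \<pi> (f - mconst c) \<in> P"
    by (intro prime_prod_mem[OF P C polys]) (simp add: P.zero_closed)
  then obtain c where c: "c \<in> C" "\<pi> (f - mconst c) \<in> P" by blast
  have "\<pi> (q c) \<notin> P"
  proof
    assume "\<pi> (q c) \<in> P"
    then obtain d where d: "d \<in> C - {c}" "\<pi> (f - mconst d) \<in> P"
      using prime_prod_mem[OF P, of "C - {c}" "\<lambda>d. f - mconst d"] C polys by (auto simp: q_def)
    \<comment> \<open>The difference of the two factors is the nonzero constant
      \<open>d - c\<close>, a unit, so a prime ideal cannot contain both.\<close>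
    have "\<pi> ((f - mconst c) - (f - mconst d)) \<in> P"
      using c(2) d(2) polys unfolding pi_diff[OF polys polys] minus_eq
      by (intro P.a_closed P.a_inv_closed)
    then have "\<pi> (mconst (inverse (d - c))) \<otimes> \<pi> (mconst (d - c)) \<in> P"
      by (intro P.I_l_closed) (simp_all add: single_diff)
    moreover have "\<pi> (mconst (inverse (d - c))) \<otimes> \<pi> (mconst (d - c)) = \<one>"
      using d(1) by (simp add: mult_single pi_one flip: pi_mult)
    ultimately have "\<one> \<in> P" by simp
    then show False using P.one_imp_carrier P.I_notcarr by auto
  qed
  define U where "U = {Q \<in> spectrum V. \<pi> (q c) \<notin> Q}"
  have "openin (spectrum_topology V) U"
    unfolding spectrum_topology_def U_def using q
    by (intro topology_generated_by_Basis) auto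
  moreover have "P \<in> U" using P \<open>\<pi> (q c) \<notin> P\<close> by (simp add: U_def spectrum_def)
  moreover have "\<pi> (f - mconst c) \<in> Q" if "Q \<in> U" for Q
  proof -
    interpret Q: primeideal Q V using that by (simp add: U_def spectrum_def)
    \<comment> \<open>The full product has image zero, so a prime ideal that avoids the cofactor
      \<open>q c\<close> must contain the factor for \<open>c\<close>.\<close>
    have "(\<Prod>d\<in>C. f - mconst d) = (f - mconst c) * q c"
      unfolding q_def by (rule prod.remove[OF C c(1)])
    then have "\<pi> (f - mconst c) \<otimes> \<pi> (q c) \<in> Q"
      using zero polys q by (simp add: pi_mult Q.zero_closed)
    then have "\<pi> (f - mconst c) \<in> Q \<or> \<pi> (q c) \<in> Q" by (intro Q.I_prime) (simp_all add: polys q)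
    then show ?thesis using that by (simp add: U_def)
  qed
  then have "const_on_points V (\<pi> f) U" unfolding const_on_points_iff[OF f] by blast
  ultimately show "\<exists>U. openin (spectrum_topology V) U \<and> P \<in> U \<and> const_on_points V (\<pi> f) U" by blast
qed

text \<open>Basic open sets pull back to basic open sets: the one given by \<open>\<pi> h\<close>
  has as preimage the nonvanishing set of \<open>h\<close>. Continuity is what carries
  neighbourhoods in the spectrum back to \<open>S\<close>.\<close>

lemma continuous_map_point_ideal:
  "continuous_map (subtopology (zariski n) S) (spectrum_topology V) point_ideal"
  unfolding spectrum_topology_def continuous_on_generated_topo_iff topspace_subtopology_zariski[OF S]
proof (intro conjI allI impI)
  fix U assume "U \<in> (\<lambda>a. {P \<in> spectrum V. a \<notin> P}) ` carrier V"
  then obtain h where h: "h \<in> polys n" "U = {P \<in> spectrum V. \<pi> h \<notin> P}" by (auto elim: carrierE)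
  then have "point_ideal -` U \<inter> S = {x \<in> S. mpoly_eval h x \<noteq> 0}"
    by (auto simp: spectrum_def primeideal_point_ideal point_ideal_iff)
  then show "openin (subtopology (zariski n) S) (point_ideal -` U \<inter> S)"
    using openin_basic_zariski[OF S h(1)] by simp
next
  \<comment> \<open>The generated topology lives on the union of its generators; the generator of
    \<open>\<pi> 1\<close> already contains all ideals of points.\<close>
  show "point_ideal ` S \<subseteq> \<Union> ((\<lambda>a. {P \<in> spectrum V. a \<notin> P}) ` carrier V)"
  proof (intro image_subsetI UnionI[OF imageI[OF pi_closed[of 1]]])
    fix x assume "x \<in> S"
    then show "point_ideal x \<in> {P \<in> spectrum V. \<pi> 1 \<notin> P}"
      by (simp add: spectrum_def primeideal_point_ideal point_ideal_iff)
  qed simp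
qed

lemma regular_locally_constant_iff:
  assumes f: "f \<in> polys n"
  shows "regular_locally_constant V (\<pi> f) \<longleftrightarrow>
    locally_constant (subtopology (zariski n) S) (mpoly_eval f)"
proof
  assume lc: "regular_locally_constant V (\<pi> f)"
  show "locally_constant (subtopology (zariski n) S) (mpoly_eval f)"
    unfolding locally_constant_def topspace_subtopology_zariski[OF S]
  proof
    fix x assume x: "x \<in> S"
    then have "point_ideal x \<in> spectrum V" by (simp add: spectrum_def primeideal_point_ideal)
    then obtain U where U: "openin (spectrum_topology V) U" "point_ideal x \<in> U"
        "const_on_points V (\<pi> f) U"
      using lc unfolding regular_locally_constant_def by blast
    then obtain c where c: "\<And>P. P \<in> U \<Longrightarrow> \<pi> (f - mconst c) \<in> P"
      unfolding const_on_points_iff[OF f] by blast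
    have "openin (subtopology (zariski n) S) {y \<in> S. point_ideal y \<in> U}"
      using openin_continuous_map_preimage[OF continuous_map_point_ideal U(1)]
      unfolding topspace_subtopology_zariski[OF S] .
    moreover have "mpoly_eval f y = c" if "y \<in> S" "point_ideal y \<in> U" for y
      using c[OF that(2)] that(1) f by (simp add: point_ideal_iff polys_diff mpoly_eval_diff)
    then have "mpoly_eval f constant_on {y \<in> S. point_ideal y \<in> U}" by (auto simp: constant_on_def)
    ultimately show "\<exists>U. openin (subtopology (zariski n) S) U \<and> x \<in> U \<and> mpoly_eval f constant_on U"
      using x U(2) by blast
  qed
qed (rule regular_locally_constant_of_locally_constant[OF f])

text \<open>The contrapositive of the definition, read through \<open>\<pi>\<close>: having no zero
  on the closure means factoring through \<open>Gm\<close>, and surjectivity of \<open>\<pi>\<close>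
  lets \<open>f\<close> reach every regular function.\<close>

lemma fundamental_iff:
  "fundamental n S \<longleftrightarrow> (\<forall>g\<in>carrier V. factors_through_Gm V g \<longrightarrow> regular_constant V g)"
  unfolding fundamental_def surj[symmetric] ball_simps
  using zero_on_closure_iff regular_constant_iff by blast

lemma locally_fundamental_iff:
  "locally_fundamental n S \<longleftrightarrow>
    (\<forall>g\<in>carrier V. factors_through_Gm V g \<longrightarrow> regular_locally_constant V g)"
  unfolding locally_fundamental_def surj[symmetric] ball_simps
  using zero_on_closure_iff regular_locally_constant_iff by blast

end

text \<open>The quotient map followed by the isomorphism; its kernel is exactly I(S) because the
  isomorphism is injective.\<close>

lemma presentation_of_isomorphism:
  fixes V :: "('a::field, 'r, 'm) module_scheme"
  assumes V: "affine_variety V" and S: "algebraic_set n S"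
    and iso: "alg_isomorphic (coordinate_ring n S) V"
  obtains \<pi> where "presentation V n S \<pi>"
proof -
  let ?I = "vanishing_ideal n S"
  interpret V: algebra "ring_of_type_algebra :: 'a ring" V using V by (simp add: affine_variety_def)
  interpret P: unital_alg "poly_alg n :: ('a, 'a mpoly) module" by (rule unital_alg_poly_alg)
  have scalar [simp]: "c \<in> carrier (ring_of_type_algebra :: 'a ring)" for c
    by (simp add: ring_of_type_algebra_def)
  have alg: "unital_alg V"
    by (intro unital_alg.intro unital_alg_axioms.intro V.ring_axioms) (simp_all add: V.smult_assoc2)
  obtain h where h: "h \<in> alg_hom (coordinate_ring n S) V"
      "bij_betw h (carrier (coordinate_ring n S)) (carrier V)"
    using iso unfolding alg_isomorphic_def by blast
  note proj = P.quot_alg_proj[OF ideal_vanishing, folded coordinate_ring_def]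
  note carr = P.carrier_quot_alg[OF ideal_vanishing, folded coordinate_ring_def]
  define \<pi> where "\<pi> = h \<circ> (+>\<^bsub>poly_alg n\<^esub>) ?I"
  have hom: "\<pi> \<in> alg_hom (poly_alg n) V" unfolding \<pi>_def by (rule alg_hom_comp[OF proj h(1)])
  have carrier: "carrier (poly_alg n) = polys n" by (simp add: poly_alg_def)
  have surj: "\<pi> ` polys n = carrier V"
    using bij_betw_imp_surj_on[OF h(2)] unfolding carr carrier \<pi>_def image_comp .
  have zero: "\<pi> 0 = \<zero>\<^bsub>V\<^esub>"
    using ring_hom_zero[of \<pi> "poly_alg n" V] hom P.ring_axioms V.ring_axioms
    by (simp add: alg_hom_def poly_alg_def)
  have "\<pi> f = \<zero>\<^bsub>V\<^esub> \<longleftrightarrow> f \<in> ?I" if f: "f \<in> polys n" for f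
  proof -
    have "\<pi> f = \<zero>\<^bsub>V\<^esub> \<longleftrightarrow> ?I +>\<^bsub>poly_alg n\<^esub> f = ?I +>\<^bsub>poly_alg n\<^esub> 0"
      unfolding zero[symmetric] \<pi>_def o_def
      using bij_betw_imp_inj_on[OF h(2)] f unfolding carr carrier by (intro inj_on_eq_iff) auto
    also have "\<dots> \<longleftrightarrow> f \<ominus>\<^bsub>poly_alg n\<^esub> 0 \<in> ?I"
      using P.quotient_eq_iff_same_a_r_cos[OF ideal_vanishing, of f 0] f by (simp add: carrier)
    also have "f \<ominus>\<^bsub>poly_alg n\<^esub> 0 = f"
    proof -
      have "f \<ominus>\<^bsub>poly_alg n\<^esub> \<zero>\<^bsub>poly_alg n\<^esub> = f"
        using f by (simp only: carrier P.minus_eq P.minus_zero P.r_zero)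
      then show ?thesis by (simp add: poly_alg_def)
    qed
    finally show ?thesis .
  qed
  then show thesis
    using that alg S hom surj V.is_cring by (auto intro!: presentation.intro presentation_axioms.intro)
qed

theorem proposition2p9:
  fixes V :: "('a::field, 'r, 'm) module_scheme"
    and n :: nat and S :: "(nat \<Rightarrow> 'a) set"
  assumes "infinite (UNIV :: 'a set)"
    and "affine_variety V"
    and "algebraic_set n S"
    and "alg_isomorphic (coordinate_ring n S) V"
  shows "(fundamental n S \<longleftrightarrow>
            (\<forall>g\<in>carrier V. factors_through_Gm V g \<longrightarrow> regular_constant V g))
       \<and> (locally_fundamental n S \<longleftrightarrow>
            (\<forall>g\<in>carrier V. factors_through_Gm V g \<longrightarrow> regular_locally_constant V g))
       \<and> (\<forall>m. \<forall>T :: (nat \<Rightarrow> 'a) set.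
            algebraic_set m T \<and> alg_isomorphic (coordinate_ring m T) V \<longrightarrow>
              (fundamental n S \<longleftrightarrow> fundamental m T) \<and>
              (locally_fundamental n S \<longleftrightarrow> locally_fundamental m T))"
proof -
  \<comment> \<open>Stated for an arbitrary embedding \<open>T\<close> in dimension
    \<open>m\<close>. The right-hand sides mention only V, so two embeddings of V are compared
    through them.\<close>
  have char: "(fundamental m T \<longleftrightarrow>
        (\<forall>g\<in>carrier V. factors_through_Gm V g \<longrightarrow> regular_constant V g)) \<and>
      (locally_fundamental m T \<longleftrightarrow>
        (\<forall>g\<in>carrier V. factors_through_Gm V g \<longrightarrow> regular_locally_constant V g))"
    if T: "algebraic_set m T" "alg_isomorphic (coordinate_ring m T) V" for m and T :: "(nat \<Rightarrow> 'a) set"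
  proof -
    obtain \<pi> where "presentation V m T \<pi>"
      using presentation_of_isomorphism[OF assms(2) T] .
    then show ?thesis
      by (intro conjI presentation.fundamental_iff presentation.locally_fundamental_iff)
  qed
  show ?thesis
    using char[OF assms(3,4)] char by simp
qed

end
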